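(* Let $f:Y\to X$ be a cover of strongly connected finite digraphs. Then $g_X^*(1)$ divides $g_Y^*(1)$ in $\mathbb{Z}$. If in addition $\delta(X)=\delta(Y)=0$, then $m(X)\mid m(Y)$. If moreover $r_X=r_Y$ (still with $\delta(X)=\delta(Y)=0$), then the group morphism $\mathrm{BF}(Y)_{\rm tors}\to\mathrm{BF}(X)_{\rm tors}$ induced by $f$ is surjective, and $\#\mathrm{BF}(X)_{\rm tors}\mid\#\mathrm{BF}(Y)_{\rm tors}$.
   Context: Digraph $X=(V_X,E_X)$ with incidence $e\mapsto(o(e),t(e))$; strongly connected means a directed path exists between any two distinct vertices. A morphism $f:Y\to X$ is a pair of maps on vertices and edges compatible with $o$ and $t$. It is a cover if $f$ is surjective on vertices and for every $w\in V_Y$ it restricts to bijections $\{\varepsilon:o(\varepsilon)=w\}\to\{e:o(e)=f(w)\}$ and $\{\varepsilon:t(\varepsilon)=w\}\to\{e:t(e)=f(w)\}$. For finite $X$: $\mathcal{A}_X(v)=\sum_{o(e)=v}t(e)$ on $\mathbb{Z}V_X$, $\mathrm{BF}(X)=\mathrm{coker}(\mathcal{I}-\mathcal{A}_X)$, $g_X(u)=\det(\mathcal{I}-\mathcal{A}_Xu)\in\mathbb{Z}[u]$, $r_X=\mathrm{ord}_{u=1}g_X$, $g_X^*(1)$ the coefficient of $(u-1)^{r_X}$ in the Taylor expansion at $1$, $\delta(X)=r_X-\mathrm{rank}_{\mathbb{Z}}\mathrm{BF}(X)$, and when $\delta(X)=0$, $m(X)$ is the nonzero integer with $g_X^*(1)=m(X)\#\mathrm{BF}(X)_{\rm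 tors}$. The map $f$ induces $\mathbb{Z}V_Y\to\mathbb{Z}V_X$ intertwining the adjacency operators, hence a surjection $\mathrm{BF}(Y)\to\mathrm{BF}(X)$. *)

theory Defs
  imports "HOL-Algebra.Coset" "HOL-Algebra.FiniteProduct"
    "HOL-Combinatorics.Permutations" "HOL-Computational_Algebra.Polynomial"
begin

record ('v,'e) digraph =
  verts :: "'v set"
  arcs  :: "'e set"
  orig  :: "'e \<Rightarrow> 'v"
  targ  :: "'e \<Rightarrow> 'v"

definition fin_digraph :: "('v,'e) digraph \<Rightarrow> bool" where
  "fin_digraph X \<longleftrightarrow> finite (verts X) \<and> finite (arcs X) \<and>
     orig X ` arcs X \<subseteq> verts X \<and> targ X ` arcs X \<subseteq> verts X"

definition arc_rel :: "('v,'e) digraph \<Rightarrow> ('v \<times> 'v) set" where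
  "arc_rel X = {(orig X e, targ X e) | e. e \<in> arcs X}"

definition strongly_connected :: "('v,'e) digraph \<Rightarrow> bool" where
  "strongly_connected X \<longleftrightarrow>
     (\<forall>u\<in>verts X. \<forall>v\<in>verts X. u \<noteq> v \<longrightarrow> (u, v) \<in> (arc_rel X)\<^sup>+)"

definition digraph_morphism ::
  "('w,'d) digraph \<Rightarrow> ('v,'e) digraph \<Rightarrow> ('w \<Rightarrow> 'v) \<Rightarrow> ('d \<Rightarrow> 'e) \<Rightarrow> bool" where
  "digraph_morphism Y X fV fE \<longleftrightarrow>
     fV ` verts Y \<subseteq> verts X \<and> fE ` arcs Y \<subseteq> arcs X \<and>
     (\<forall>e\<in>arcs Y. orig X (fE e) = fV (orig Y e) \<and> targ X (fE e) = fV (targ Y e))"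

definition is_cover ::
  "('w,'d) digraph \<Rightarrow> ('v,'e) digraph \<Rightarrow> ('w \<Rightarrow> 'v) \<Rightarrow> ('d \<Rightarrow> 'e) \<Rightarrow> bool" where
  "is_cover Y X fV fE \<longleftrightarrow> digraph_morphism Y X fV fE \<and> fV ` verts Y = verts X \<and>
     (\<forall>w\<in>verts Y.
        bij_betw fE {\<epsilon>\<in>arcs Y. orig Y \<epsilon> = w} {e\<in>arcs X. orig X e = fV w} \<and>
        bij_betw fE {\<epsilon>\<in>arcs Y. targ Y \<epsilon> = w} {e\<in>arcs X. targ X e = fV w})"

text \<open>Z V as functions V \<rightarrow> int (zero outside V), written multiplicatively as an
  HOL-Algebra monoid record (mult = pointwise addition).\<close>
definition zvec :: "'v set \<Rightarrow> ('v \<Rightarrow> int) monoid" where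
  "zvec V = \<lparr>carrier = {x. \<forall>v. v \<notin> V \<longrightarrow> x v = 0},
             monoid.mult = (\<lambda>x y. \<lambda>v. x v + y v), monoid.one = (\<lambda>_. 0)\<rparr>"

text \<open>A_X(v) = sum over edges e with o(e)=v of t(e); on coordinates:
  (A x)(w) = sum over edges e with t(e)=w of x(o(e)).\<close>
definition adj_op :: "('v,'e) digraph \<Rightarrow> ('v \<Rightarrow> int) \<Rightarrow> ('v \<Rightarrow> int)" where
  "adj_op X x = (\<lambda>w. if w \<in> verts X then (\<Sum>e\<in>{e\<in>arcs X. targ X e = w}. x (orig X e)) else 0)"

definition I_minus_A :: "('v,'e) digraph \<Rightarrow> ('v \<Rightarrow> int) \<Rightarrow> ('v \<Rightarrow> int)" where
  "I_minus_A X x = (\<lambda>w. x w - adj_op X x w)"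

definition BF_sub :: "('v,'e) digraph \<Rightarrow> ('v \<Rightarrow> int) set" where
  "BF_sub X = I_minus_A X ` carrier (zvec (verts X))"

definition BF :: "('v,'e) digraph \<Rightarrow> ('v \<Rightarrow> int) set monoid" where
  "BF X = zvec (verts X) Mod BF_sub X"

definition tors :: "('a,'b) monoid_scheme \<Rightarrow> 'a set" where
  "tors G = {a \<in> carrier G. \<exists>n::nat. n > 0 \<and> a [^]\<^bsub>G\<^esub> n = \<one>\<^bsub>G\<^esub>}"

definition Z_indep :: "('a,'b) monoid_scheme \<Rightarrow> 'a set \<Rightarrow> bool" where
  "Z_indep G S \<longleftrightarrow> finite S \<and> S \<subseteq> carrier G \<and>
     (\<forall>c :: 'a \<Rightarrow> int. finprod G (\<lambda>s. s [^]\<^bsub>G\<^esub> c s) S = \<one>\<^bsub>G\<^esub> \<longrightarrow> (\<forall>s\<in>S. c s = 0))"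

definition Z_rank :: "('a,'b) monoid_scheme \<Rightarrow> nat" where
  "Z_rank G = Sup {card S | S. Z_indep G S}"

definition det_on :: "'v set \<Rightarrow> ('v \<Rightarrow> 'v \<Rightarrow> 'a::comm_ring_1) \<Rightarrow> 'a" where
  "det_on V M = (\<Sum>p | p permutes V. of_int (sign p) * (\<Prod>v\<in>V. M v (p v)))"

definition adj_mat :: "('v,'e) digraph \<Rightarrow> 'v \<Rightarrow> 'v \<Rightarrow> int" where
  "adj_mat X w v = int (card {e\<in>arcs X. orig X e = v \<and> targ X e = w})"

definition gpoly :: "('v,'e) digraph \<Rightarrow> int poly" where
  "gpoly X = det_on (verts X)
     (\<lambda>w v. (if w = v then 1 else 0) - smult (adj_mat X w v) [:0, 1:])"

definition r_ord :: "('v,'e) digraph \<Rightarrow> nat" where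
  "r_ord X = Polynomial.order 1 (gpoly X)"

text \<open>Coefficient of (u-1)^r in the Taylor expansion at 1.\<close>
definition gstar :: "('v,'e) digraph \<Rightarrow> int" where
  "gstar X = coeff (pcompose (gpoly X) [:1, 1:]) (r_ord X)"

definition delta :: "('v,'e) digraph \<Rightarrow> int" where
  "delta X = int (r_ord X) - int (Z_rank (BF X))"

definition mX :: "('v,'e) digraph \<Rightarrow> int" where
  "mX X = (THE m. m \<noteq> 0 \<and> gstar X = m * int (card (tors (BF X))))"

definition pushfwd :: "('w \<Rightarrow> 'v) \<Rightarrow> 'w set \<Rightarrow> 'v set \<Rightarrow> ('w \<Rightarrow> int) \<Rightarrow> ('v \<Rightarrow> int)" where
  "pushfwd fV VY VX x = (\<lambda>v. if v \<in> VX then (\<Sum>w\<in>{w\<in>VY. fV w = v}. x w) else 0)"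

text \<open>The class of x maps to the class of f_* x (computed as a coset product).\<close>
definition BF_map ::
  "('w,'d) digraph \<Rightarrow> ('v,'e) digraph \<Rightarrow> ('w \<Rightarrow> 'v) \<Rightarrow> ('w \<Rightarrow> int) set \<Rightarrow> ('v \<Rightarrow> int) set" where
  "BF_map Y X fV C = BF_sub X <#>\<^bsub>zvec (verts X)\<^esub> (pushfwd fV (verts Y) (verts X) ` C)"

end

theory Submission
  imports Defs "Jordan_Normal_Form.Char_Poly"
begin

text \<open>
  Write \<open>B = 1 - A\<close> for a finite digraph and diagonalise it over the integers,
  \<open>U B V = diag (D, 0)\<close> with \<open>U\<close>, \<open>V\<close> unimodular and \<open>D\<close> nonsingular of size \<open>k\<close>. Then the torsion of
  \<open>BF(X)\<close> has order \<open>|det D|\<close>, its rank is the size \<open>r\<close> of the zero block, and since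
  \<open>1 - u A = (1 - u) 1 + u B\<close>, the polynomial \<open>g\<close> is, up to sign, \<open>(u - 1)^r\<close> times a polynomial
  whose value at \<open>1\<close> is \<open>det D det W\<close>, where \<open>W\<close> is the lower right \<open>r \<times> r\<close> block of \<open>U V\<close>. Hence
  \<open>m(X) = \<plusminus> det W\<close> when \<open>\<delta>(X) = 0\<close>.

  All three divisibilities come from one fact: if \<open>S W' = W T\<close> with \<open>W\<close>, \<open>W'\<close> square and \<open>S\<close> right
  invertible, then \<open>det W\<close> divides \<open>det W'\<close>. The push-forward matrix of a cover is right invertible
  and intertwines the adjacency matrices, which gives \<open>g_X | g_Y\<close>; in the diagonalising coordinates
  it is block triangular, and its diagonal blocks give \<open>m(X) | m(Y)\<close> and, when both free ranks agree,
  the statements on torsion.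
\<close>

section \<open>Intertwined determinants and diagonalisation of integer matrices\<close>

lemma four_block_mat_inject:
  assumes "A \<in> carrier_mat a c" "B \<in> carrier_mat a d" "C \<in> carrier_mat b c" "D \<in> carrier_mat b d"
    and "A' \<in> carrier_mat a c" "B' \<in> carrier_mat a d" "C' \<in> carrier_mat b c" "D' \<in> carrier_mat b d"
    and eq: "four_block_mat A B C D = four_block_mat A' B' C' D'"
  shows "A = A'" "B = B'" "C = C'" "D = D'"
proof -
  have E: "four_block_mat A B C D $$ (i,j) = four_block_mat A' B' C' D' $$ (i,j)" for i j
    using eq by simp
  show "A = A'"
  proof (rule eq_matI)
    fix i j assume "i < dim_row A'" "j < dim_col A'"
    then show "A $$ (i,j) = A' $$ (i,j)" using E[of i j] assms(1-8) by simp
  qed (use assms in auto)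
  show "B = B'"
  proof (rule eq_matI)
    fix i j assume "i < dim_row B'" "j < dim_col B'"
    then show "B $$ (i,j) = B' $$ (i,j)" using E[of i "j + c"] assms(1-8) by simp
  qed (use assms in auto)
  show "C = C'"
  proof (rule eq_matI)
    fix i j assume "i < dim_row C'" "j < dim_col C'"
    then show "C $$ (i,j) = C' $$ (i,j)" using E[of "i + a" j] assms(1-8) by simp
  qed (use assms in auto)
  show "D = D'"
  proof (rule eq_matI)
    fix i j assume "i < dim_row D'" "j < dim_col D'"
    then show "D $$ (i,j) = D' $$ (i,j)" using E[of "i + a" "j + c"] assms(1-8) by simp
  qed (use assms in auto)
qed

lemma four_block_mat_cases:
  assumes "A \<in> carrier_mat (a + b) (c + d)"
  obtains A1 A2 A3 A4 where "A1 \<in> carrier_mat a c" "A2 \<in> carrier_mat a d"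
    "A3 \<in> carrier_mat b c" "A4 \<in> carrier_mat b d" "A = four_block_mat A1 A2 A3 A4"
proof -
  obtain A1 A2 A3 A4 where s: "split_block A a c = (A1, A2, A3, A4)"
    by (metis prod.exhaust)
  show thesis
    by (rule that) (use split_block[OF s, of b d] assms in auto)
qed

text \<open>The right inverse \<open>R\<close> lets the rectangular \<open>S\<close> be bordered to
  a square matrix \<open>N\<close> whose determinant is a unit. The hypothesis \<open>SW\<close>
  then becomes an equation \<open>N * E = E' * K\<close> between square matrices with
  \<open>det E = det W\<close> and \<open>det E' = det W'\<close>, and taking determinants gives the
  divisibility.\<close>

lemma det_dvd_of_intertwining:
  fixes S :: "'a :: idom mat"
  assumes S: "S \<in> carrier_mat a b" and R: "R \<in> carrier_mat b a" and SR: "S * R = 1\<^sub>m a"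
    and W: "W \<in> carrier_mat b b" and W': "W' \<in> carrier_mat a a" and T: "T \<in> carrier_mat a b"
    and SW: "S * W = W' * T"
  shows "det W' dvd det W"
proof -
  define N where "N = four_block_mat (0\<^sub>m a a) S (- R) (1\<^sub>m b)"
  \<comment> \<open>The block row operation \<open>P\<close> uses \<open>S * R = 1\<close> to make
    \<open>N\<close> lower triangular with identity diagonal blocks.\<close>
  define P where "P = four_block_mat (1\<^sub>m a) (- S) (0\<^sub>m b a) (1\<^sub>m b)"
  define K where "K = four_block_mat (0\<^sub>m a a) T (- R) W"
  have car: "N \<in> carrier_mat (a+b) (a+b)" "P \<in> carrier_mat (a+b) (a+b)" "K \<in> carrier_mat (a+b) (a+b)"
    unfolding N_def P_def K_def using W by auto
  have "P * N = four_block_mat (1\<^sub>m a) (0\<^sub>m a b) (- R) (1\<^sub>m b)"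
    unfolding P_def N_def
    by (subst mult_four_block_mat[of _ a a _ b _ b _ _ a _ b]) (use S R SR in auto)
  then have "det (P * N) = 1"
    using R by (simp add: det_four_block_mat_upper_right_zero[of _ a _ b])
  then have unit: "det P * det N = 1" using car by (simp add: det_mult[of _ "a+b"])
  define E where "E = four_block_mat (1\<^sub>m a) (0\<^sub>m a b) (0\<^sub>m b a) W"
  define E' where "E' = four_block_mat W' (0\<^sub>m a b) (0\<^sub>m b a) (1\<^sub>m b)"
  have carE: "E \<in> carrier_mat (a+b) (a+b)" "E' \<in> carrier_mat (a+b) (a+b)"
    unfolding E_def E'_def using W W' by auto
  have dE: "det E = det W" "det E' = det W'" unfolding E_def E'_def using W W'
    by (simp_all add: det_four_block_mat_upper_right_zero[of _ a _ b])
  have "N * E = four_block_mat (0\<^sub>m a a) (S * W) (- R) W"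
    unfolding N_def E_def
    by (subst mult_four_block_mat[of _ a a _ b _ b _ _ a _ b]) (use S R W in auto)
  moreover have "E' * K = four_block_mat (0\<^sub>m a a) (W' * T) (- R) W"
    unfolding K_def E'_def
    by (subst mult_four_block_mat[of _ a a _ b _ b _ _ a _ b]) (use T R W W' in auto)
  ultimately have "N * E = E' * K" using SW by simp
  then have "det N * det W = det W' * det K"
    using car carE dE by (metis det_mult)
  then have "det P * det N * det W = det W' * (det P * det K)" by (simp add: ac_simps)
  then show ?thesis using unit by simp
qed

section \<open>Unimodular equivalence and diagonal form over the integers\<close>

definition unimodular :: "nat \<Rightarrow> int mat \<Rightarrow> bool" where
  "unimodular n U \<longleftrightarrow> U \<in> carrier_mat n n \<and> det U dvd 1"

lemma unimodular_carrier: "unimodular n U \<Longrightarrow> U \<in> carrier_mat n n"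
  by (simp add: unimodular_def)

lemma unimodular_one: "unimodular n (1\<^sub>m n)"
  by (simp add: unimodular_def)

lemma unimodular_mult:
  assumes "unimodular n U" "unimodular n V" shows "unimodular n (U * V)"
proof -
  have "det (U * V) = det U * det V" using assms by (auto simp: unimodular_def det_mult)
  then show ?thesis using assms by (auto simp: unimodular_def abs_mult)
qed

lemma unimodular_transpose: "unimodular n U \<Longrightarrow> unimodular n U\<^sup>T"
  by (auto simp: unimodular_def det_transpose)

text \<open>As \<open>det U\<close> is 1 or -1, it is its own inverse, and \<open>det U\<close>
  times the adjugate inverts \<open>U\<close> on both sides.\<close>

lemma unimodular_inverse:
  assumes "unimodular n U"
  obtains U' where "U' \<in> carrier_mat n n" "U * U' = 1\<^sub>m n" "U' * U = 1\<^sub>m n"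
proof -
  have U: "U \<in> carrier_mat n n" and "det U dvd 1" using assms by (auto simp: unimodular_def)
  then have d: "det U * det U = 1" by (metis abs_mult_self_eq mult_1 zdvd1_eq)
  note a = Determinant.adj_mat[OF U]
  show thesis
  proof (rule that)
    show "det U \<cdot>\<^sub>m Determinant.adj_mat U \<in> carrier_mat n n" using a by simp
    have "U * (det U \<cdot>\<^sub>m Determinant.adj_mat U) = (det U * det U) \<cdot>\<^sub>m 1\<^sub>m n"
      unfolding mult_smult_distrib[OF U a(1)] a(2) by (intro eq_matI) auto
    then show "U * (det U \<cdot>\<^sub>m Determinant.adj_mat U) = 1\<^sub>m n" using d by auto
    have "det U \<cdot>\<^sub>m Determinant.adj_mat U * U = (det U * det U) \<cdot>\<^sub>m 1\<^sub>m n"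
      unfolding mult_smult_assoc_mat[OF a(1) U] a(3) by (intro eq_matI) auto
    then show "det U \<cdot>\<^sub>m Determinant.adj_mat U * U = 1\<^sub>m n" using d by auto
  qed
qed

definition unimod_equiv :: "nat \<Rightarrow> nat \<Rightarrow> int mat \<Rightarrow> int mat \<Rightarrow> bool" where
  "unimod_equiv m n M N \<longleftrightarrow> (\<exists>U V. unimodular m U \<and> unimodular n V \<and> N = U * M * V)"

lemma unimod_equivI:
  "unimodular m U \<Longrightarrow> unimodular n V \<Longrightarrow> N = U * M * V \<Longrightarrow> unimod_equiv m n M N"
  by (auto simp: unimod_equiv_def)

lemma unimod_equiv_carrier:
  "unimod_equiv m n M N \<Longrightarrow> M \<in> carrier_mat m n \<Longrightarrow> N \<in> carrier_mat m n"
  by (auto simp: unimod_equiv_def unimodular_def)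

lemma unimod_equiv_refl: "M \<in> carrier_mat m n \<Longrightarrow> unimod_equiv m n M M"
  by (rule unimod_equivI[OF unimodular_one unimodular_one]) auto

lemma unimod_equiv_trans:
  assumes M: "M \<in> carrier_mat m n" and "unimod_equiv m n M N" "unimod_equiv m n N K"
  shows "unimod_equiv m n M K"
proof -
  obtain U V U' V' where *: "unimodular m U" "unimodular n V" "N = U * M * V"
     "unimodular m U'" "unimodular n V'" "K = U' * N * V'"
    using assms by (auto simp: unimod_equiv_def)
  note c = *(1,2,4,5)[THEN unimodular_carrier]
  have "K = (U' * U) * M * (V * V')"
    unfolding *(6,3) using M c
    by (smt (verit, ccfv_threshold) assoc_mult_mat mult_carrier_mat)
  then show ?thesis using * by (intro unimod_equivI[OF unimodular_mult unimodular_mult])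
qed

lemma unimod_equiv_transpose:
  assumes M: "M \<in> carrier_mat m n" and "unimod_equiv m n M N"
  shows "unimod_equiv n m M\<^sup>T N\<^sup>T"
proof -
  obtain U V where *: "unimodular m U" "unimodular n V" "N = U * M * V"
    using assms by (auto simp: unimod_equiv_def)
  note c = *(1,2)[THEN unimodular_carrier]
  have "N\<^sup>T = V\<^sup>T * (U * M)\<^sup>T" unfolding * using c M by (intro transpose_mult[of _ m n _ n]) auto
  also have "\<dots> = V\<^sup>T * M\<^sup>T * U\<^sup>T" using c M
    by (simp add: transpose_mult[OF c(1) M] assoc_mult_mat[of _ n n _ m _ m])
  finally show ?thesis using * by (intro unimod_equivI[OF unimodular_transpose unimodular_transpose])
qed

lemma unimod_equiv_swaprows:
  assumes M: "M \<in> carrier_mat m n" and "k < m" "l < m"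
  shows "unimod_equiv m n M (swaprows k l M)"
proof (cases "k = l")
  case True
  then have "swaprows k l M = M" by (intro eq_matI) auto
  then show ?thesis using unimod_equiv_refl[OF M] by simp
next
  case False
  have "unimodular m (swaprows_mat m k l)"
    using det_swaprows_mat[of k m l, where 'a = int] False assms by (simp add: unimodular_def)
  then show ?thesis
    by (rule unimod_equivI[OF _ unimodular_one]) (use M swaprows_mat[OF M] assms in auto)
qed

lemma unimod_equiv_addrow:
  assumes M: "M \<in> carrier_mat m n" and "k < m" "l < m" "k \<noteq> l"
  shows "unimod_equiv m n M (addrow a k l M)"
proof -
  have "unimodular m (addrow_mat m a k l)"
    using det_addrow_mat[of k l m a] assms by (simp add: unimodular_def)
  then show ?thesis
    by (rule unimod_equivI[OF _ unimodular_one]) (use M addrow_mat[OF M] assms in auto)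
qed

text \<open>Euclid's algorithm: among all equivalent matrices take one with a nonzero corner entry of
  least absolute value; it divides its row and column.\<close>

lemma unimod_equiv_corner:
  assumes M: "M \<in> carrier_mat (Suc m) (Suc n)" and nz: "M \<noteq> 0\<^sub>m (Suc m) (Suc n)"
  obtains a M' where "a \<noteq> 0" "M' \<in> carrier_mat m n"
    "unimod_equiv (Suc m) (Suc n) M (four_block_mat (a \<cdot>\<^sub>m 1\<^sub>m 1) (0\<^sub>m 1 n) (0\<^sub>m m 1) M')"
proof -
  let ?eq = "unimod_equiv (Suc m) (Suc n)" and ?eqT = "unimod_equiv (Suc n) (Suc m)"
  \<comment> \<open>Column operations are row operations on the transpose; \<open>T\<close> and
    \<open>Ts\<close> pass between the two sides.\<close>
  have T: "?eq M N\<^sup>T" if "?eqT M\<^sup>T N" for N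
    using unimod_equiv_transpose[OF _ that] M by simp
  have Ts: "?eqT M\<^sup>T N\<^sup>T" if "?eq M N" for N
    using unimod_equiv_transpose[OF M that] .
  have carT: "N \<in> carrier_mat (Suc n) (Suc m)" if "?eqT M\<^sup>T N" for N
    using unimod_equiv_carrier[OF that] M by simp
  have tr: "?eq M K" if "?eq M N" "?eq N K" for N K using unimod_equiv_trans[OF M that] .
  have trT: "?eqT M\<^sup>T K" if "?eqT M\<^sup>T N" "?eqT N K" for N K
    using unimod_equiv_trans[OF _ that] M by simp
  have car: "N \<in> carrier_mat (Suc m) (Suc n)" if "?eq M N" for N
    using unimod_equiv_carrier[OF that M] .
  define P where "P N \<longleftrightarrow> ?eq M N \<and> N $$ (0,0) \<noteq> 0" for N
  have ex: "\<exists>N. P N"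
  proof -
    obtain i j where ij: "i < Suc m" "j < Suc n" "M $$ (i,j) \<noteq> 0"
      using nz M by (metis carrier_matD eq_matI index_zero_mat(1) zero_carrier_mat)
    let ?N = "swaprows 0 i M"
    have N: "?eq M ?N" by (rule unimod_equiv_swaprows[OF M]) (use ij in auto)
    have "?eqT M\<^sup>T (swaprows 0 j ?N\<^sup>T)"
      by (rule trT[OF Ts[OF N] unimod_equiv_swaprows[OF carT[OF Ts[OF N]]]]) (use ij in auto)
    then have "?eq M (swaprows 0 j ?N\<^sup>T)\<^sup>T" by (rule T)
    moreover have "(swaprows 0 j ?N\<^sup>T)\<^sup>T $$ (0,0) = M $$ (i,j)"
      using M ij by auto
    ultimately show ?thesis using ij unfolding P_def by metis
  qed
  define N where "N = (ARG_MIN (\<lambda>N. nat \<bar>N $$ (0,0)\<bar>) N. P N)"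
  have PN: "P N" and min: "P K \<Longrightarrow> nat \<bar>N $$ (0,0)\<bar> \<le> nat \<bar>K $$ (0,0)\<bar>" for K
    unfolding N_def using arg_min_nat_lemma[of P] ex by metis+
  have N: "N \<in> carrier_mat (Suc m) (Suc n)" and MN: "?eq M N" and N0: "N $$ (0,0) \<noteq> 0"
    using PN car by (auto simp: P_def)
  have small: "K $$ (0,0) = 0" if "?eq M K" "\<bar>K $$ (0,0)\<bar> < \<bar>N $$ (0,0)\<bar>" for K
    using min[of K] that by (fastforce simp: P_def)
  \<comment> \<open>Subtracting \<open>?q\<close> times the top row leaves a remainder in row
    \<open>i\<close>, and a swap moves it to the corner. It is smaller than the least nonzero corner
    entry, so it is 0.\<close>
  have colz: "N $$ (0,0) dvd N $$ (i,0)" if i: "i < Suc m" for i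
  proof (cases "i = 0")
    case False
    let ?q = "N $$ (i,0) div N $$ (0,0)"
    let ?A = "addrow (- ?q) i 0 N"
    have A: "?eq M ?A" by (rule tr[OF MN unimod_equiv_addrow[OF N]]) (use i False in auto)
    have K: "?eq M (swaprows 0 i ?A)" by (rule tr[OF A unimod_equiv_swaprows[OF car[OF A]]]) (use i in auto)
    have e: "swaprows 0 i ?A $$ (0,0) = N $$ (i,0) mod N $$ (0,0)"
      using N i False by (auto simp: minus_div_mult_eq_mod[symmetric])
    have "N $$ (i,0) mod N $$ (0,0) = 0"
      using small[OF K] unfolding e using N0 abs_mod_less by blast
    then show ?thesis by auto
  qed auto
  have rowz: "N $$ (0,0) dvd N $$ (0,j)" if j: "j < Suc n" for j
  proof (cases "j = 0")
    case False
    let ?q = "N $$ (0,j) div N $$ (0,0)"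
    let ?A = "addrow (- ?q) j 0 N\<^sup>T"
    have NT: "N\<^sup>T \<in> carrier_mat (Suc n) (Suc m)" using N by simp
    have A: "?eqT M\<^sup>T ?A" by (rule trT[OF Ts[OF MN] unimod_equiv_addrow[OF NT]]) (use j False in auto)
    have K: "?eqT M\<^sup>T (swaprows 0 j ?A)"
      by (rule trT[OF A unimod_equiv_swaprows[OF carT[OF A]]]) (use j in auto)
    have e: "(swaprows 0 j ?A)\<^sup>T $$ (0,0) = N $$ (0,j) mod N $$ (0,0)"
      using N j False by (auto simp: minus_div_mult_eq_mod[symmetric])
    have "N $$ (0,j) mod N $$ (0,0) = 0"
      using small[OF T[OF K]] unfolding e using N0 abs_mod_less by blast
    then show ?thesis by auto
  qed auto
  have "N \<in> carrier_mat (1 + m) (1 + n)" using N by simp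
  then obtain N1 N2 N3 N4 where Nb: "N1 \<in> carrier_mat 1 1" "N2 \<in> carrier_mat 1 n"
    "N3 \<in> carrier_mat m 1" "N4 \<in> carrier_mat m n" "N = four_block_mat N1 N2 N3 N4"
    by (rule four_block_mat_cases)
  let ?a = "N $$ (0,0)"
  have N1: "N1 = ?a \<cdot>\<^sub>m 1\<^sub>m 1" using Nb by (intro eq_matI) auto
  define x where "x = mat m 1 (\<lambda>(i,j). N $$ (Suc i, 0) div ?a)"
  define y where "y = mat 1 n (\<lambda>(i,j). N $$ (0, Suc j) div ?a)"
  have xy: "x \<in> carrier_mat m 1" "y \<in> carrier_mat 1 n" by (auto simp: x_def y_def)
  have N3: "N3 = ?a \<cdot>\<^sub>m x"
  proof (rule eq_matI)
    fix i j assume "i < dim_row (?a \<cdot>\<^sub>m x)" "j < dim_col (?a \<cdot>\<^sub>m x)"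
    then have ij: "i < m" "j = 0" using xy by auto
    have "N3 $$ (i,j) = N $$ (Suc i, 0)" using Nb ij by auto
    then show "N3 $$ (i,j) = (?a \<cdot>\<^sub>m x) $$ (i,j)" using ij colz[of "Suc i"] by (simp add: x_def)
  qed (use Nb xy in auto)
  have N2: "N2 = ?a \<cdot>\<^sub>m y"
  proof (rule eq_matI)
    fix i j assume "i < dim_row (?a \<cdot>\<^sub>m y)" "j < dim_col (?a \<cdot>\<^sub>m y)"
    then have ij: "i = 0" "j < n" using xy by auto
    have "N2 $$ (i,j) = N $$ (0, Suc j)" using Nb ij by auto
    then show "N2 $$ (i,j) = (?a \<cdot>\<^sub>m y) $$ (i,j)" using ij rowz[of "Suc j"] by (simp add: y_def)
  qed (use Nb xy in auto)
  \<comment> \<open>Since the corner entry divides its column and row with quotients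
    \<open>x\<close> and \<open>y\<close>, \<open>U\<close> clears the column by subtracting
    multiples of the top row, and \<open>V\<close> clears the row by subtracting multiples of the
    first column.\<close>
  define U where "U = four_block_mat (1\<^sub>m 1) (0\<^sub>m 1 m) (- x) (1\<^sub>m m)"
  define V where "V = four_block_mat (1\<^sub>m 1) (- y) (0\<^sub>m n 1) (1\<^sub>m n)"
  have U: "unimodular (Suc m) U" unfolding unimodular_def U_def using xy
      four_block_carrier_mat[of "1\<^sub>m 1" 1 1 "1\<^sub>m m" m m]
    by (simp add: det_four_block_mat_upper_right_zero[of _ 1 _ m])
  have V: "unimodular (Suc n) V" unfolding unimodular_def V_def using xy
      four_block_carrier_mat[of "1\<^sub>m 1" 1 1 "1\<^sub>m n" n n]
    by (simp add: det_four_block_mat_lower_left_zero[of _ 1 _ n])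
  define M' where "M' = - x * N2 + N4"
  have M': "M' \<in> carrier_mat m n" using xy Nb by (auto simp: M'_def)
  have "U * N = four_block_mat N1 N2 (- x * N1 + N3) M'"
    unfolding U_def Nb(5) M'_def using xy Nb
    by (subst mult_four_block_mat[of _ 1 1 _ m _ m _ _ 1 _ n]) auto
  also have "- x * N1 + N3 = 0\<^sub>m m 1"
    unfolding N1 N3 using xy by (intro eq_matI) auto
  finally have UN: "U * N = four_block_mat N1 N2 (0\<^sub>m m 1) M'" .
  have "U * N * V = four_block_mat N1 (N1 * (- y) + N2) (0\<^sub>m m 1) M'"
    unfolding UN V_def using xy Nb M'
    by (subst mult_four_block_mat[of _ 1 1 _ n _ m _ _ 1 _ n]) auto
  also have "N1 * (- y) + N2 = 0\<^sub>m 1 n"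
    unfolding N1 N2 using xy by (intro eq_matI) auto
  finally have "?eq N (four_block_mat (?a \<cdot>\<^sub>m 1\<^sub>m 1) (0\<^sub>m 1 n) (0\<^sub>m m 1) M')"
    using N1 by (intro unimod_equivI[OF U V]) simp
  then show thesis using that[OF N0 M'] tr[OF MN] by blast
qed

text \<open>Smith normal form up to the divisibility chain: \<open>unimod_equiv_corner\<close>
  splits off one nonzero entry, the induction diagonalises the remaining block, and a zero matrix
  ends the recursion with \<open>k = 0\<close>.\<close>

lemma unimod_equiv_diagonal:
  fixes M :: "int mat"
  assumes "M \<in> carrier_mat m n"
  shows "\<exists>k d. k \<le> m \<and> k \<le> n \<and> (\<forall>i<k. d i \<noteq> 0) \<and>
    unimod_equiv m n M (mat m n (\<lambda>(i,j). if i = j \<and> i < k then d i else 0))"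
  using assms
proof (induction m arbitrary: n M)
  case 0
  have *: "mat 0 n (\<lambda>(i,j). if i = j \<and> i < 0 then 0 else 0) = M" using 0 by (intro eq_matI) auto
  have "unimod_equiv 0 n M (mat 0 n (\<lambda>(i,j). if i = j \<and> i < 0 then 0 else 0))"
    unfolding * by (rule unimod_equiv_refl[OF 0])
  then show ?case by (intro exI[of _ 0] exI[of _ "\<lambda>_. 0"] conjI) (auto simp only:)
next
  case (Suc m)
  note M = Suc.prems
  show ?case
  proof (cases "M = 0\<^sub>m (Suc m) n")
    case True
    then have *: "mat (Suc m) n (\<lambda>(i,j). if i = j \<and> i < 0 then 0 else 0) = M" by (intro eq_matI) auto
    have "unimod_equiv (Suc m) n M (mat (Suc m) n (\<lambda>(i,j). if i = j \<and> i < 0 then 0 else 0))"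
      unfolding * by (rule unimod_equiv_refl[OF M])
    then show ?thesis by (intro exI[of _ 0] exI[of _ "\<lambda>_. 0"] conjI) (auto simp only:)
  next
    case False
    then obtain n' where n: "n = Suc n'" using M by (cases n) auto
    obtain a M' where a: "a \<noteq> 0" and M': "M' \<in> carrier_mat m n'"
      and eq: "unimod_equiv (Suc m) n M (four_block_mat (a \<cdot>\<^sub>m 1\<^sub>m 1) (0\<^sub>m 1 n') (0\<^sub>m m 1) M')"
      using unimod_equiv_corner[of M m n'] M False n by auto
    obtain k d U V where kd: "k \<le> m" "k \<le> n'" "\<forall>i<k. d i \<noteq> 0"
      and UV: "unimodular m U" "unimodular n' V"
      and D: "mat m n' (\<lambda>(i,j). if i = j \<and> i < k then d i else 0) = U * M' * V"
      using Suc.IH[OF M'] unfolding unimod_equiv_def by auto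
    note c = UV[THEN unimodular_carrier]
    define U1 where "U1 = four_block_mat (1\<^sub>m 1) (0\<^sub>m 1 m) (0\<^sub>m m 1) U"
    define V1 where "V1 = four_block_mat (1\<^sub>m 1) (0\<^sub>m 1 n') (0\<^sub>m n' 1) V"
    have U1: "unimodular (Suc m) U1" and V1: "unimodular n V1" using UV n
      unfolding unimodular_def U1_def V1_def
      using four_block_carrier_mat[of "1\<^sub>m 1" 1 1 U m m] four_block_carrier_mat[of "1\<^sub>m 1" 1 1 V n' n']
      by (simp_all add: det_four_block_mat_upper_right_zero[of _ 1 _ m] det_four_block_mat_upper_right_zero[of _ 1 _ n'])
    \<comment> \<open>The new corner takes index 0 and shifts the diagonal of the smaller block by
      one.\<close>
    let ?d = "\<lambda>i. if i = 0 then a else d (i - 1)"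
    have "U1 * four_block_mat (a \<cdot>\<^sub>m 1\<^sub>m 1) (0\<^sub>m 1 n') (0\<^sub>m m 1) M' * V1
      = four_block_mat (a \<cdot>\<^sub>m 1\<^sub>m 1) (0\<^sub>m 1 n') (0\<^sub>m m 1) (U * M') * V1"
      unfolding U1_def using c M'
      by (subst mult_four_block_mat[of _ 1 1 _ m _ m _ _ 1 _ n']) auto
    also have "\<dots> = four_block_mat (a \<cdot>\<^sub>m 1\<^sub>m 1) (0\<^sub>m 1 n') (0\<^sub>m m 1) (U * M' * V)"
      unfolding V1_def using c M'
      by (subst mult_four_block_mat[of _ 1 1 _ n' _ m _ _ 1 _ n']) auto
    also have "\<dots> = mat (Suc m) n (\<lambda>(i,j). if i = j \<and> i < Suc k then ?d i else 0)"
      unfolding D[symmetric] n by (intro eq_matI) auto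
    finally have "unimod_equiv (Suc m) n M (mat (Suc m) n (\<lambda>(i,j). if i = j \<and> i < Suc k then ?d i else 0))"
      by (intro unimod_equiv_trans[OF M eq] unimod_equivI[OF U1 V1]) simp
    then show ?thesis using kd a n
      by (intro exI[of _ "Suc k"] exI[of _ ?d]) auto
  qed
qed

section \<open>Diagonally presented abelian groups\<close>

text \<open>In diagonal form the last column is zero, because \<open>k\<close> is at most
  \<open>r\<close> and \<open>r < p\<close>. So the last unit vector lies in the kernel of
  \<open>D\<close>, and its image under the invertible \<open>V\<close> is a nonzero kernel vector
  of \<open>M\<close>.\<close>

lemma exists_int_kernel_vector:
  fixes M :: "int mat"
  assumes M: "M \<in> carrier_mat r p" and rp: "r < p"
  obtains c where "c \<in> carrier_vec p" "c \<noteq> 0\<^sub>v p" "M *\<^sub>v c = 0\<^sub>v r"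
proof -
  obtain k d where k: "k \<le> r"
    and eq: "unimod_equiv r p M (mat r p (\<lambda>(i,j). if i = j \<and> i < k then d i else 0))"
    using unimod_equiv_diagonal[OF M] by blast
  define D where "D = mat r p (\<lambda>(i,j). if i = j \<and> i < k then d i else (0 :: int))"
  obtain U V where UV: "unimodular r U" "unimodular p V" "D = U * M * V"
    using eq unfolding unimod_equiv_def D_def by blast
  note c = UV(1,2)[THEN unimodular_carrier]
  obtain U' where U': "U' \<in> carrier_mat r r" "U' * U = 1\<^sub>m r" using unimodular_inverse[OF UV(1)] .
  obtain V' where V': "V' \<in> carrier_mat p p" "V' * V = 1\<^sub>m p" using unimodular_inverse[OF UV(2)] .
  let ?e = "unit_vec p (p - 1) :: int vec"
  let ?c = "V *\<^sub>v ?e"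
  have cc: "?c \<in> carrier_vec p" using c by simp
  have "D *\<^sub>v ?e = 0\<^sub>v r"
  proof (rule eq_vecI)
    fix i assume "i < dim_vec (0\<^sub>v r :: int vec)"
    then have i: "i < r" by simp
    have D: "D \<in> carrier_mat r p" by (simp add: D_def)
    have "(D *\<^sub>v ?e) $ i = D $$ (i, p - 1)"
      using i rp D by simp
    then show "(D *\<^sub>v ?e) $ i = 0\<^sub>v r $ i" using i k rp by (auto simp: D_def)
  qed (simp add: D_def)
  then have "U *\<^sub>v (M *\<^sub>v ?c) = 0\<^sub>v r"
    unfolding UV(3) using c M by (simp add: assoc_mult_mat_vec[of _ r p _ p] assoc_mult_mat_vec[of _ r r _ p])
  moreover have "U' * U *\<^sub>v (M *\<^sub>v ?c) = U' *\<^sub>v (U *\<^sub>v (M *\<^sub>v ?c))"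
    by (rule assoc_mult_mat_vec[of _ r r _ r]) (use c M U' in auto)
  ultimately have "U' * U *\<^sub>v (M *\<^sub>v ?c) = 0\<^sub>v r" using U'(1) by (auto intro!: eq_vecI)
  then have "M *\<^sub>v ?c = 0\<^sub>v r" using U' M cc by simp
  moreover have "?c \<noteq> 0\<^sub>v p"
  proof
    assume "?c = 0\<^sub>v p"
    moreover have "V' * V *\<^sub>v ?e = V' *\<^sub>v (V *\<^sub>v ?e)"
      by (rule assoc_mult_mat_vec[of _ p p _ p]) (use c V' in auto)
    ultimately have "V' * V *\<^sub>v ?e = 0\<^sub>v p" using V'(1) by (auto intro!: eq_vecI)
    then have "?e $ (p - 1) = 0\<^sub>v p $ (p - 1)" using V' by simp
    then show False using rp by simp
  qed
  ultimately show thesis using that cc by blast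
qed

text \<open>The group \<open>Q\<close> is presented as the product of the cyclic groups \<open>\<int> / d i\<close> for \<open>i < k\<close> and a
  free group of rank \<open>n - k\<close>.\<close>

locale diagonal_presentation = comm_group Q for Q (structure) +
  fixes h :: "int vec \<Rightarrow> 'a" and n k :: nat and d :: "nat \<Rightarrow> int"
  assumes k_le: "k \<le> n" and d_nonzero: "\<And>i. i < k \<Longrightarrow> d i \<noteq> 0"
    and h_image: "h ` carrier_vec n = carrier Q"
    and h_add: "\<And>u v. u \<in> carrier_vec n \<Longrightarrow> v \<in> carrier_vec n \<Longrightarrow> h (u + v) = h u \<otimes> h v"
    and h_eq_iff: "\<And>u v. u \<in> carrier_vec n \<Longrightarrow> v \<in> carrier_vec n \<Longrightarrow>
      h u = h v \<longleftrightarrow> (\<forall>i<n. (if i < k then d i else 0) dvd u $ i - v $ i)"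
begin

lemma h_closed: "u \<in> carrier_vec n \<Longrightarrow> h u \<in> carrier Q"
  using h_image by auto

lemma h_zero: "h (0\<^sub>v n) = \<one>"
proof -
  have "h (0\<^sub>v n) \<otimes> h (0\<^sub>v n) = h (0\<^sub>v n)" using h_add[of "0\<^sub>v n" "0\<^sub>v n"] by simp
  then show ?thesis using h_closed[of "0\<^sub>v n"] by simp
qed

lemma h_eq_one_iff:
  "u \<in> carrier_vec n \<Longrightarrow> h u = \<one> \<longleftrightarrow> (\<forall>i<n. (if i < k then d i else 0) dvd u $ i)"
  using h_eq_iff[of u "0\<^sub>v n"] by (auto simp: h_zero)

lemma h_nat_pow: "u \<in> carrier_vec n \<Longrightarrow> h u [^] (m::nat) = h (int m \<cdot>\<^sub>v u)"
proof (induction m)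
  case 0
  have "0 \<cdot>\<^sub>v u = 0\<^sub>v n" using 0 by auto
  then show ?case by (simp add: h_zero)
next
  case (Suc m)
  have "int (Suc m) \<cdot>\<^sub>v u = int m \<cdot>\<^sub>v u + u" by (intro eq_vecI) (auto simp: algebra_simps)
  then show ?case using Suc by (simp add: h_add)
qed

lemma h_int_pow:
  assumes u: "u \<in> carrier_vec n" shows "h u [^] (c::int) = h (c \<cdot>\<^sub>v u)"
proof (cases "c \<ge> 0")
  case True
  then obtain m where "c = int m" using zero_le_imp_eq_int by blast
  then show ?thesis using h_nat_pow[OF u, of m] by (simp add: int_pow_int)
next
  case False
  then obtain m where m: "c = - int m" by (metis linorder_not_le minus_minus nonpos_int_cases order_less_imp_le)
  have "h (c \<cdot>\<^sub>v u) \<otimes> h (int m \<cdot>\<^sub>v u) = h (c \<cdot>\<^sub>v u + int m \<cdot>\<^sub>v u)" using u by (simp add: h_add)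
  also have "c \<cdot>\<^sub>v u + int m \<cdot>\<^sub>v u = 0\<^sub>v n" using u m by (intro eq_vecI) auto
  finally have "h (c \<cdot>\<^sub>v u) = inv (h (int m \<cdot>\<^sub>v u))"
    using u h_closed by (simp add: h_zero inv_equality)
  then show ?thesis using m h_closed[OF u] h_nat_pow[OF u, of m]
    by (simp add: int_pow_neg int_pow_int)
qed

lemma h_finprod:
  assumes "finite S" "\<And>s. s \<in> S \<Longrightarrow> g s \<in> carrier_vec n"
  shows "finprod Q (\<lambda>s. h (g s)) S = h (vec n (\<lambda>i. \<Sum>s\<in>S. g s $ i))"
  using assms
proof (induction S rule: finite_induct)
  case empty
  have "vec n (\<lambda>i. 0) = (0\<^sub>v n :: int vec)" by auto
  then show ?case by (simp add: h_zero)
next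
  case (insert s S)
  have "vec n (\<lambda>i. \<Sum>s\<in>insert s S. g s $ i) = g s + vec n (\<lambda>i. \<Sum>s\<in>S. g s $ i)"
    using insert by (intro eq_vecI) auto
  then show ?case using insert by (simp add: h_closed h_add Pi_def)
qed

section \<open>Torsion subgroup and rank of a diagonally presented group\<close>

definition torsion_vecs :: "int vec set" where
  "torsion_vecs = {u \<in> carrier_vec n. \<forall>i<n. k \<le> i \<longrightarrow> u $ i = 0}"

text \<open>A common multiple of all moduli, hence an annihilator of the torsion. For
  \<open>k = 0\<close> it is the empty product 1, so it is positive in every case.\<close>

definition exponent_bound :: nat where
  "exponent_bound = nat \<bar>\<Prod>i<k. d i\<bar>"

lemma exponent_bound_pos: "exponent_bound > 0"
  using d_nonzero by (auto simp: exponent_bound_def)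

lemma dvd_exponent_bound: "i < k \<Longrightarrow> d i dvd int exponent_bound"
  using dvd_prodI[of "{..<k}" i d] by (simp add: exponent_bound_def)

lemma torsion_vecs_pow:
  assumes "u \<in> torsion_vecs" shows "h (int exponent_bound \<cdot>\<^sub>v u) = \<one>"
  using assms dvd_exponent_bound by (subst h_eq_one_iff) (auto simp: torsion_vecs_def)

text \<open>A free coordinate has modulus 0, and 0 divides only 0. So if a positive multiple of
  \<open>u\<close> has trivial class, the free coordinates of \<open>u\<close> vanish; conversely
  \<open>exponent_bound\<close> kills every vector supported on the first \<open>k\<close>
  coordinates.\<close>

lemma tors_eq: "tors Q = h ` torsion_vecs"
proof
  show "tors Q \<subseteq> h ` torsion_vecs"
  proof
    fix a assume a: "a \<in> tors Q"
    then obtain u where u: "u \<in> carrier_vec n" "a = h u" using h_image by (auto simp: tors_def)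
    obtain m :: nat where m: "m > 0" "h (int m \<cdot>\<^sub>v u) = \<one>"
      using a u by (auto simp: tors_def h_nat_pow)
    have "u $ i = 0" if "i < n" "k \<le> i" for i
      using m u that by (subst (asm) h_eq_one_iff) auto
    then show "a \<in> h ` torsion_vecs" using u by (auto simp: torsion_vecs_def)
  qed
  show "h ` torsion_vecs \<subseteq> tors Q"
  proof
    fix a assume "a \<in> h ` torsion_vecs"
    then obtain u where u: "u \<in> torsion_vecs" "a = h u" by auto
    then have "u \<in> carrier_vec n" by (simp add: torsion_vecs_def)
    then show "a \<in> tors Q"
      using torsion_vecs_pow[OF u(1)] u exponent_bound_pos h_closed
      by (auto simp: tors_def h_nat_pow)
  qed
qed

text \<open>Reducing coordinate \<open>i\<close> modulo \<open>\<bar>d i\<bar>\<close> selects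
  exactly one representative of each torsion class in the box \<open>?P\<close>, so counting torsion
  classes is counting lattice points of that box.\<close>

lemma card_tors: "int (card (tors Q)) = \<bar>\<Prod>i<k. d i\<bar>"
proof -
  let ?P = "PiE {..<k} (\<lambda>i. {0..<\<bar>d i\<bar>})"
  let ?u = "\<lambda>c. vec n (\<lambda>i. if i < k then c i else 0)"
  have "bij_betw (\<lambda>c. h (?u c)) ?P (tors Q)"
    unfolding bij_betw_def
  proof
    show "inj_on (\<lambda>c. h (?u c)) ?P"
    proof (rule inj_onI)
      fix c c' assume c: "c \<in> ?P" "c' \<in> ?P" and eq: "h (?u c) = h (?u c')"
      show "c = c'"
      proof (rule PiE_ext[OF c])
        fix i assume i: "i \<in> {..<k}"
        then have "d i dvd c i - c' i" using eq k_le by (subst (asm) h_eq_iff) (auto dest!: spec[of _ i])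
        moreover have "\<bar>c i - c' i\<bar> < \<bar>d i\<bar>" using PiE_mem[OF c(1) i] PiE_mem[OF c(2) i] by auto
        ultimately show "c i = c' i" using dvd_imp_le_int[of "c i - c' i" "d i"] by linarith
      qed
    qed
    show "(\<lambda>c. h (?u c)) ` ?P = tors Q"
    proof
      show "(\<lambda>c. h (?u c)) ` ?P \<subseteq> tors Q" unfolding tors_eq by (auto simp: torsion_vecs_def)
      show "tors Q \<subseteq> (\<lambda>c. h (?u c)) ` ?P"
      proof
        fix a assume "a \<in> tors Q"
        then obtain v where v: "v \<in> carrier_vec n" "\<And>i. i < n \<Longrightarrow> k \<le> i \<Longrightarrow> v $ i = 0" "a = h v"
          unfolding tors_eq by (auto simp: torsion_vecs_def)
        let ?c = "\<lambda>i\<in>{..<k}. v $ i mod \<bar>d i\<bar>"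
        have "?c \<in> ?P" using d_nonzero by auto
        moreover have "h v = h (?u ?c)"
        proof (subst h_eq_iff)
          show "\<forall>i<n. (if i < k then d i else 0) dvd v $ i - ?u ?c $ i"
          proof (intro allI impI)
            fix i assume i: "i < n"
            have "d i dvd v $ i - v $ i mod \<bar>d i\<bar>" using dvd_minus_mod[of "\<bar>d i\<bar>" "v $ i"] by (simp only: abs_dvd_iff)
            then show "(if i < k then d i else 0) dvd v $ i - ?u ?c $ i" using v i by auto
          qed
        qed (use v in auto)
        ultimately show "a \<in> (\<lambda>c. h (?u c)) ` ?P" using v by blast
      qed
    qed
  qed
  then have "card (tors Q) = card ?P" using bij_betw_same_card by metis
  also have "\<dots> = (\<Prod>i<k. nat \<bar>d i\<bar>)" by (simp add: card_PiE)
  finally show ?thesis by (simp add: abs_prod)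
qed

text \<open>The free coordinates of more than \<open>n - k\<close> elements are linearly dependent
  over the integers. The corresponding combination is a torsion element, and a suitable multiple of
  it is a nontrivial relation.\<close>

lemma Z_indep_card_le:
  assumes S: "Z_indep Q S" shows "card S \<le> n - k"
proof (rule ccontr)
  assume less: "\<not> card S \<le> n - k"
  have fin: "finite S" and Sc: "S \<subseteq> carrier Q" using S by (auto simp: Z_indep_def)
  have "\<forall>s\<in>S. \<exists>u. u \<in> carrier_vec n \<and> h u = s" using Sc unfolding h_image[symmetric] by auto
  then obtain x where x: "\<And>s. s \<in> S \<Longrightarrow> x s \<in> carrier_vec n" "\<And>s. s \<in> S \<Longrightarrow> h (x s) = s"
    by metis
  define p where "p = card S"
  obtain f where f: "bij_betw f {0..<p} S" using ex_bij_betw_nat_finite[OF fin] unfolding p_def by blast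
  define M where "M = mat (n - k) p (\<lambda>(i,j). x (f j) $ (i + k))"
  have M: "M \<in> carrier_mat (n - k) p" by (simp add: M_def)
  obtain c where c: "c \<in> carrier_vec p" "c \<noteq> 0\<^sub>v p" "M *\<^sub>v c = 0\<^sub>v (n - k)"
    using exists_int_kernel_vector[OF M] less unfolding p_def by auto
  define g where "g = inv_into {0..<p} f"
  have gf: "g (f j) = j" if "j < p" for j using f that by (simp add: g_def bij_betw_def)
  define C where "C s = int exponent_bound * c $ (g s)" for s
  let ?v = "vec n (\<lambda>i. \<Sum>s\<in>S. c $ (g s) * x s $ i)"
  have sum: "(\<Sum>s\<in>S. F s) = (\<Sum>j = 0..<p. F (f j))" for F :: "'a \<Rightarrow> int"
    using sum.reindex_bij_betw[OF f, of F] by simp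
  have "?v \<in> torsion_vecs"
    unfolding torsion_vecs_def
  proof (intro CollectI conjI allI impI)
    fix i assume i: "i < n" "k \<le> i"
    have "?v $ i = (\<Sum>j = 0..<p. c $ j * x (f j) $ i)" using i by (simp add: sum gf)
    also have "\<dots> = (M *\<^sub>v c) $ (i - k)"
      using i c(1) by (simp add: M_def scalar_prod_def mult.commute)
    finally show "?v $ i = 0" using c(3) i by simp
  qed simp
  then have one: "h (int exponent_bound \<cdot>\<^sub>v ?v) = \<one>" by (rule torsion_vecs_pow)
  have "finprod Q (\<lambda>s. s [^] C s) S = finprod Q (\<lambda>s. h (C s \<cdot>\<^sub>v x s)) S"
  proof (rule finprod_cong')
    fix s assume s: "s \<in> S"
    show "s [^] C s = h (C s \<cdot>\<^sub>v x s)" using h_int_pow[OF x(1)[OF s], of "C s"] x(2)[OF s] by simp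
  qed (use x h_closed in auto)
  also have "\<dots> = h (vec n (\<lambda>i. \<Sum>s\<in>S. (C s \<cdot>\<^sub>v x s) $ i))"
    by (rule h_finprod[OF fin]) (use x in simp)
  also have "vec n (\<lambda>i. \<Sum>s\<in>S. (C s \<cdot>\<^sub>v x s) $ i) = int exponent_bound \<cdot>\<^sub>v ?v"
  proof (rule eq_vecI)
    fix i assume "i < dim_vec (int exponent_bound \<cdot>\<^sub>v ?v)"
    then have i: "i < n" by simp
    have "(\<Sum>s\<in>S. (C s \<cdot>\<^sub>v x s) $ i) = (\<Sum>s\<in>S. int exponent_bound * (c $ (g s) * x s $ i))"
      using x(1) i by (intro sum.cong) (auto simp: C_def carrier_vecD[OF x(1)])
    then show "vec n (\<lambda>i. \<Sum>s\<in>S. (C s \<cdot>\<^sub>v x s) $ i) $ i = (int exponent_bound \<cdot>\<^sub>v ?v) $ i"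
      using i by (simp add: sum_distrib_left)
  qed simp
  finally have "finprod Q (\<lambda>s. s [^] C s) S = \<one>" using one by simp
  then have z: "\<forall>s\<in>S. C s = 0" using S by (simp add: Z_indep_def)
  have "c = 0\<^sub>v p"
  proof (rule eq_vecI)
    fix j assume "j < dim_vec (0\<^sub>v p :: int vec)"
    then have j: "j < p" by simp
    then have "C (f j) = 0" using z f by (auto simp: bij_betw_def)
    then show "c $ j = 0\<^sub>v p $ j" using j gf exponent_bound_pos by (simp add: C_def)
  qed (use c in simp)
  then show False using c by simp
qed

lemma exists_Z_indep: "\<exists>S. Z_indep Q S \<and> card S = n - k"
proof -
  let ?e = "\<lambda>i. h (unit_vec n i)"
  let ?S = "?e ` {k..<n}"
  \<comment> \<open>Independence is stated for sets, so the cardinality depends on distinct unit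
    vectors having distinct classes: in a free coordinate two representatives of one class agree
    exactly.\<close>
  have inj: "inj_on ?e {k..<n}"
  proof (rule inj_onI)
    fix i j assume ij: "i \<in> {k..<n}" "j \<in> {k..<n}" "?e i = ?e j"
    then have "(unit_vec n i :: int vec) $ i - unit_vec n j $ i = 0"
      by (subst (asm) h_eq_iff) (auto dest!: spec[of _ i] simp del: index_unit_vec)
    then show "i = j" using ij by (auto split: if_splits)
  qed
  have "Z_indep Q ?S" unfolding Z_indep_def
  proof (intro conjI allI impI ballI)
    show "?S \<subseteq> carrier Q" using h_closed by auto
    fix c :: "'a \<Rightarrow> int" and s assume c: "finprod Q (\<lambda>s. s [^] c s) ?S = \<one>" and s: "s \<in> ?S"
    let ?w = "vec n (\<lambda>i. \<Sum>j\<in>{k..<n}. (c (?e j) \<cdot>\<^sub>v unit_vec n j) $ i)"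
    have "finprod Q (\<lambda>s. s [^] c s) ?S = finprod Q (\<lambda>j. ?e j [^] c (?e j)) {k..<n}"
      by (rule finprod_reindex[OF _ inj]) (auto simp: h_closed)
    also have "\<dots> = finprod Q (\<lambda>j. h (c (?e j) \<cdot>\<^sub>v unit_vec n j)) {k..<n}"
      by (rule finprod_cong') (auto simp: h_int_pow h_closed)
    also have "\<dots> = h ?w" by (rule h_finprod) auto
    finally have w: "h ?w = \<one>" using c by simp
    obtain i where i: "i \<in> {k..<n}" "s = ?e i" using s by blast
    have "?w $ i = 0" using w i by (subst (asm) h_eq_one_iff) auto
    moreover have "?w $ i = (\<Sum>j\<in>{k..<n}. if i = j then c (?e i) else 0)"
      using i by (simp add: if_distrib[of "(*) _"] cong: if_cong)
    ultimately show "c s = 0" using i by simp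
  qed simp
  moreover have "card ?S = n - k" using card_image[OF inj] by simp
  ultimately show ?thesis by blast
qed

lemma Z_rank_eq: "Z_rank Q = n - k"
proof -
  obtain S where S: "Z_indep Q S" "card S = n - k" using exists_Z_indep by blast
  show ?thesis unfolding Z_rank_def
    by (rule cSup_eq_maximum) (use S Z_indep_card_le in \<open>auto intro!: exI[of _ S]\<close>)
qed

end

section \<open>Block decompositions and the expansion at 1\<close>

text \<open>Conjugation by the enumeration \<open>e\<close> matches the permutations of the index
  range with those of \<open>V\<close> and preserves the sign, so the two Leibniz sums agree term by
  term.\<close>

lemma det_on_eq_det:
  fixes M :: "'v \<Rightarrow> 'v \<Rightarrow> 'a :: comm_ring_1"
  assumes e: "bij_betw e {0..<n} V"
  shows "det_on V M = det (mat n n (\<lambda>(i,j). M (e i) (e j)))"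
proof -
  let ?m = "map_permutation {0..<n} e"
  have inj: "inj_on e {0..<n}" and img: "e ` {0..<n} = V" using e by (auto simp: bij_betw_def)
  have "?m = (\<lambda>\<pi> x. if x \<in> V then e (\<pi> (inv_into {0..<n} e x)) else x)"
    by (intro ext) (simp add: map_permutation_def restrict_id_def img)
  then have bij: "bij_betw ?m {p. p permutes {0..<n}} {p. p permutes V}"
    using bij_betw_permutations[OF e] by simp
  have "det_on V M = (\<Sum>p | p permutes {0..<n}. of_int (sign (?m p)) * (\<Prod>v\<in>V. M v (?m p v)))"
    unfolding det_on_def by (rule sum.reindex_bij_betw[OF bij, symmetric])
  also have "\<dots> = (\<Sum>p | p permutes {0..<n}. signof p * (\<Prod>i = 0..<n. M (e i) (e (p i))))"
  proof (rule sum.cong[OF refl])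
    fix p assume "p \<in> {p. p permutes {0..<n}}"
    then have p: "p permutes {0..<n}" by simp
    have "(\<Prod>v\<in>V. M v (?m p v)) = (\<Prod>i\<in>{0..<n}. M (e i) (?m p (e i)))"
      by (rule prod.reindex_bij_betw[OF e, symmetric])
    also have "\<dots> = (\<Prod>i\<in>{0..<n}. M (e i) (e (p i)))"
      by (rule prod.cong[OF refl]) (simp add: map_permutation_apply[OF inj])
    finally show "of_int (sign (?m p)) * (\<Prod>v\<in>V. M v (?m p v)) =
        signof p * (\<Prod>i = 0..<n. M (e i) (e (p i)))"
      using sign_map_permutation[OF inj p] by (simp add: sign_def)
  qed
  also have "\<dots> = det (mat n n (\<lambda>(i,j). M (e i) (e j)))"
    unfolding det_def by (auto intro!: sum.cong prod.cong dest: permutes_in_image)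
  finally show ?thesis .
qed

text \<open>Substituting \<open>u + 1\<close> for \<open>u\<close> turns \<open>(u - 1)^r\<close>
  into the monomial \<open>u^r\<close>, so the coefficient in degree \<open>r\<close> is the
  constant coefficient of the shifted \<open>q\<close>, which is its value at 1.\<close>

lemma order_and_leading_taylor_coeff:
  fixes q :: "int poly"
  assumes "poly q 1 \<noteq> 0"
  shows "Polynomial.order 1 ([:-1, 1:] ^ r * q) = r"
    and "coeff (pcompose ([:-1, 1:] ^ r * q) [:1, 1:]) r = poly q 1"
proof -
  have "Polynomial.order 1 q = 0" using assms order_root by blast
  moreover have "[:-1, 1:] ^ r * q \<noteq> 0" using assms by auto
  ultimately show "Polynomial.order 1 ([:-1, 1:] ^ r * q) = r"
    using order_mult[of "[:-1, 1:] ^ r" q 1] order_power_n_n[of "1::int" r] by simp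
  have "pcompose [:-1, 1:] [:1, 1:] = monom (1::int) 1" by (simp add: monom_altdef)
  then have "pcompose ([:-1, 1:] ^ r * q) [:1, 1:] = monom 1 r * pcompose q [:1, 1:]"
    by (simp add: pcompose_mult pcompose_hom.hom_power monom_power)
  then have "coeff (pcompose ([:-1, 1:] ^ r * q) [:1, 1:]) r = coeff (pcompose q [:1, 1:]) 0"
    by (simp add: coeff_monom_mult)
  also have "\<dots> = poly q 1" by (simp add: poly_0_coeff_0[symmetric] poly_pcompose)
  finally show "coeff (pcompose ([:-1, 1:] ^ r * q) [:1, 1:]) r = poly q 1" .
qed

lemma mult_linear_comb_mult:
  fixes P Q R :: "'a :: comm_ring_1 mat"
  assumes "P \<in> carrier_mat n n" "Q \<in> carrier_mat n n" "R \<in> carrier_mat n n"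
  shows "P * (a \<cdot>\<^sub>m 1\<^sub>m n + b \<cdot>\<^sub>m Q) * R = a \<cdot>\<^sub>m (P * R) + b \<cdot>\<^sub>m (P * Q * R)"
proof -
  have "P * (a \<cdot>\<^sub>m 1\<^sub>m n + b \<cdot>\<^sub>m Q) = P * (a \<cdot>\<^sub>m 1\<^sub>m n) + P * (b \<cdot>\<^sub>m Q)"
    by (rule mult_add_distrib_mat) (use assms in auto)
  also have "\<dots> = a \<cdot>\<^sub>m P + b \<cdot>\<^sub>m (P * Q)"
    using assms by (simp add: mult_smult_distrib[of _ n n _ n])
  also have "\<dots> * R = a \<cdot>\<^sub>m P * R + b \<cdot>\<^sub>m (P * Q) * R"
    by (rule add_mult_distrib_mat) (use assms in auto)
  also have "\<dots> = a \<cdot>\<^sub>m (P * R) + b \<cdot>\<^sub>m (P * Q * R)"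
    using assms by (simp add: mult_smult_assoc_mat[of _ n n _ n])
  finally show ?thesis .
qed

text \<open>Since \<open>1 - u A = (1 - u) 1 + u (1 - A)\<close>, multiplying by \<open>U\<close>
  and \<open>V\<close> gives \<open>(1 - u) U V\<close> plus \<open>u\<close> times the block matrix
  \<open>diag (D1, 0)\<close>. Each of the \<open>r\<close> zero rows of the latter contributes one
  factor \<open>1 - u\<close> to the determinant.\<close>

lemma det_one_minus_u_factor:
  fixes A :: "int mat"
  assumes A: "A \<in> carrier_mat (k + r) (k + r)"
    and U: "unimodular (k + r) U" and V: "unimodular (k + r) V"
    and D1: "D1 \<in> carrier_mat k k"
    and D: "U * (1\<^sub>m (k + r) - A) * V = four_block_mat D1 (0\<^sub>m k r) (0\<^sub>m r k) (0\<^sub>m r r)"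
    and W: "W1 \<in> carrier_mat k k" "W2 \<in> carrier_mat k r" "W3 \<in> carrier_mat r k" "W4 \<in> carrier_mat r r"
    and UV: "U * V = four_block_mat W1 W2 W3 W4"
  obtains q where "det (1\<^sub>m (k + r) - [:0, 1:] \<cdot>\<^sub>m map_mat (\<lambda>a. [:a:]) A) = [:-1, 1:] ^ r * q"
    and "\<bar>poly q 1\<bar> = \<bar>det D1 * det W4\<bar>"
proof -
  interpret lift: comm_ring_hom "\<lambda>a::int. [:a:]" by unfold_locales (auto simp: one_pCons)
  let ?n = "k + r"
  let ?L = "map_mat (\<lambda>a::int. [:a:])"
  let ?u = "[:0, 1:] :: int poly" and ?w = "[:1, -1:] :: int poly"
  note c = U[THEN unimodular_carrier] V[THEN unimodular_carrier]
  define g where "g = 1\<^sub>m ?n - ?u \<cdot>\<^sub>m ?L A"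
  have g: "g \<in> carrier_mat ?n ?n" using A by (auto simp: g_def)
  have "g = ?w \<cdot>\<^sub>m 1\<^sub>m ?n + ?u \<cdot>\<^sub>m ?L (1\<^sub>m ?n - A)"
  proof (rule eq_matI)
    fix i j assume "i < dim_row (?w \<cdot>\<^sub>m 1\<^sub>m ?n + ?u \<cdot>\<^sub>m ?L (1\<^sub>m ?n - A))"
      "j < dim_col (?w \<cdot>\<^sub>m 1\<^sub>m ?n + ?u \<cdot>\<^sub>m ?L (1\<^sub>m ?n - A))"
    then have ij: "i < ?n" "j < ?n" using A by auto
    let ?\<delta> = "if i = j then 1 else 0 :: int"
    have "[:?\<delta>:] - ?u * [:A $$ (i,j):] = ?w * [:?\<delta>:] + ?u * [:?\<delta> - A $$ (i,j):]"
      by simp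
    moreover have "(if i = j then 1 else 0 :: int poly) = [:?\<delta>:]" by simp
    ultimately show "g $$ (i,j) = (?w \<cdot>\<^sub>m 1\<^sub>m ?n + ?u \<cdot>\<^sub>m ?L (1\<^sub>m ?n - A)) $$ (i,j)"
      using ij A unfolding g_def by (simp only: index_add_mat index_minus_mat index_smult_mat
        index_map_mat index_one_mat carrier_matD minus_carrier_mat map_carrier_mat smult_carrier_mat)
  qed (use A in \<open>auto simp: g_def\<close>)
  then have "?L U * g * ?L V = ?w \<cdot>\<^sub>m (?L U * ?L V) + ?u \<cdot>\<^sub>m (?L U * ?L (1\<^sub>m ?n - A) * ?L V)"
    using c A minus_carrier_mat[OF A, of "1\<^sub>m ?n"]
    by (simp only:) (rule mult_linear_comb_mult[of _ ?n], auto)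
  also have "?L U * ?L V = ?L (U * V)" using c by (simp add: lift.mat_hom_mult)
  also have "?L U * ?L (1\<^sub>m ?n - A) * ?L V = ?L (U * (1\<^sub>m ?n - A) * V)"
    using c A minus_carrier_mat[OF A, of "1\<^sub>m ?n"]
    by (simp add: lift.mat_hom_mult[of _ ?n ?n _ ?n])
  finally have e1: "?L U * g * ?L V = ?w \<cdot>\<^sub>m ?L (U * V) + ?u \<cdot>\<^sub>m ?L (U * (1\<^sub>m ?n - A) * V)" .
  \<comment> \<open>The last \<open>r\<close> rows are multiples of \<open>1 - u\<close>.
    \<open>E\<close> collects these factors and \<open>M\<close> keeps the rest; at
    \<open>u = 1\<close> the matrix \<open>M\<close> is block lower triangular with diagonal blocks
    \<open>D1\<close> and \<open>W4\<close>.\<close>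
  define E where "E = four_block_mat (1\<^sub>m k) (0\<^sub>m k r) (0\<^sub>m r k) (?w \<cdot>\<^sub>m 1\<^sub>m r)"
  define M where "M = four_block_mat (?w \<cdot>\<^sub>m ?L W1 + ?u \<cdot>\<^sub>m ?L D1) (?w \<cdot>\<^sub>m ?L W2) (?L W3) (?L W4)"
  have EM: "E \<in> carrier_mat ?n ?n" "M \<in> carrier_mat ?n ?n" using W D1 by (auto simp: E_def M_def)
  have "E * M = four_block_mat (?w \<cdot>\<^sub>m ?L W1 + ?u \<cdot>\<^sub>m ?L D1) (?w \<cdot>\<^sub>m ?L W2) (?w \<cdot>\<^sub>m ?L W3) (?w \<cdot>\<^sub>m ?L W4)"
    unfolding E_def M_def using W D1
    by (subst mult_four_block_mat[of _ k k _ r _ r _ _ k _ r])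
      (auto simp: mult_smult_assoc_mat[of _ r r _ k] mult_smult_assoc_mat[of _ r r _ r])
  also have "\<dots> = ?w \<cdot>\<^sub>m ?L (U * V) + ?u \<cdot>\<^sub>m ?L (U * (1\<^sub>m ?n - A) * V)"
    unfolding UV D using W D1 by (intro eq_matI) auto
  finally have "?L U * g * ?L V = E * M" using e1 by simp
  moreover have "det (?L U * g * ?L V) = [:det U:] * det g * [:det V:]"
    using c g by (simp add: det_mult[of _ ?n])
  moreover have "det (E * M) = det E * det M" using EM by (simp add: det_mult[of _ ?n])
  ultimately have e2: "[:det U:] * det g * [:det V:] = det E * det M" by simp
  have w: "?w = - [:-1, 1:]" by (simp only: minus_pCons minus_minus minus_zero)
  have "det E = ?w ^ r" unfolding E_def
    by (subst det_four_block_mat_upper_right_zero[of _ k _ r]) auto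
  also have "?w ^ r = (-1) ^ r * [:-1, 1:] ^ r"
    unfolding w by (rule power_minus)
  finally have dE: "det E = (-1) ^ r * [:-1, 1:] ^ r" .
  have ud: "\<bar>det U\<bar> = 1" "\<bar>det V\<bar> = 1" using U V by (auto simp: unimodular_def)
  then have sq: "det U * det U = 1" "det V * det V = 1" by (metis abs_mult_self_eq mult_1)+
  \<comment> \<open>The signs \<open>det U\<close> and \<open>det V\<close> are their own inverses,
    and \<open>(1 - u)^r\<close> is \<open>(-1)^r (u - 1)^r\<close>. All these signs are absorbed
    into \<open>q\<close>, which is why its value at 1 is only given up to sign.\<close>
  define q where "q = [:det U * det V:] * (-1) ^ r * det M"
  have "det g = [:det U * det U:] * [:det V * det V:] * det g" by (simp add: sq)
  also have "\<dots> = [:det U * det V:] * ([:det U:] * det g * [:det V:])" by (simp add: ac_simps)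
  also have "\<dots> = [:-1, 1:] ^ r * q" unfolding e2 dE q_def by (simp add: ac_simps)
  finally have "det g = [:-1, 1:] ^ r * q" .
  moreover have "\<bar>poly q 1\<bar> = \<bar>det D1 * det W4\<bar>"
  proof -
    have "poly (det M) 1 = det (map_mat (\<lambda>p. poly p 1) M)" by (simp add: comm_ring_hom.hom_det[OF poly_hom.comm_ring_hom_axioms])
    also have "map_mat (\<lambda>p. poly p 1) M = four_block_mat D1 (0\<^sub>m k r) W3 W4"
      unfolding M_def using W D1 by (intro eq_matI) auto
    also have "det \<dots> = det D1 * det W4"
      by (rule det_four_block_mat_upper_right_zero) (use D1 W in auto)
    finally show ?thesis using ud by (simp add: q_def abs_mult power_abs)
  qed
  ultimately show thesis using that unfolding g_def by blast
qed

text \<open>The adjugate stands in for an inverse of \<open>D\<close>: it turns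
  \<open>C * D = 0\<close> into \<open>det D\<close> times \<open>C\<close> being 0, and the entries
  lie in a domain.\<close>

lemma mat_mult_right_cancel_zero:
  fixes C :: "'a :: idom mat"
  assumes C: "C \<in> carrier_mat m k" and D: "D \<in> carrier_mat k k" and "det D \<noteq> 0" "C * D = 0\<^sub>m m k"
  shows "C = 0\<^sub>m m k"
proof -
  note a = Determinant.adj_mat[OF D]
  have "0\<^sub>m m k = C * D * Determinant.adj_mat D" using assms a by simp
  also have "\<dots> = C * (D * Determinant.adj_mat D)" by (rule assoc_mult_mat[OF C D a(1)])
  also have "\<dots> = det D \<cdot>\<^sub>m C" unfolding a(2) using C by (simp add: mult_smult_distrib[OF C one_carrier_mat])
  finally have e: "(det D \<cdot>\<^sub>m C) $$ ij = (0\<^sub>m m k :: 'a mat) $$ ij" for ij by simp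
  show ?thesis
  proof (rule eq_matI)
    fix i j assume "i < dim_row (0\<^sub>m m k :: 'a mat)" "j < dim_col (0\<^sub>m m k :: 'a mat)"
    then show "C $$ (i,j) = 0\<^sub>m m k $$ (i,j)" using e[of "(i,j)"] C \<open>det D \<noteq> 0\<close> by auto
  qed (use C in auto)
qed

lemma mat_mult_left_cancel_zero:
  fixes C :: "'a :: idom mat"
  assumes C: "C \<in> carrier_mat k m" and D: "D \<in> carrier_mat k k" and "det D \<noteq> 0" "D * C = 0\<^sub>m k m"
  shows "C = 0\<^sub>m k m"
proof -
  have "C\<^sup>T * D\<^sup>T = (D * C)\<^sup>T" using transpose_mult[OF D C] by simp
  then have "C\<^sup>T * D\<^sup>T = 0\<^sub>m m k" using assms(4) by simp
  then have "C\<^sup>T = 0\<^sub>m m k"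
    using mat_mult_right_cancel_zero[of "C\<^sup>T" m k "D\<^sup>T"] assms by (simp add: det_transpose)
  then show ?thesis by (metis transpose_transpose zero_transpose_mat)
qed

text \<open>\<open>S\<close> is the map induced on the torsion-free quotients of the cokernels.\<close>

lemma intertwining_blocks:
  fixes G H R :: "int mat"
  assumes G: "G \<in> carrier_mat (k + r) (l + s)" and H: "H \<in> carrier_mat (k + r) (l + s)"
    and R: "R \<in> carrier_mat (l + s) (k + r)" and GR: "G * R = 1\<^sub>m (k + r)"
    and D: "D \<in> carrier_mat k k" "det D \<noteq> 0" and D': "D' \<in> carrier_mat l l" "det D' \<noteq> 0"
    and GD: "G * four_block_mat D' (0\<^sub>m l s) (0\<^sub>m s l) (0\<^sub>m s s) =
      four_block_mat D (0\<^sub>m k r) (0\<^sub>m r k) (0\<^sub>m r r) * H"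
    and W: "W1 \<in> carrier_mat k k" "W2 \<in> carrier_mat k r" "W3 \<in> carrier_mat r k" "W4 \<in> carrier_mat r r"
    and W': "W1' \<in> carrier_mat l l" "W2' \<in> carrier_mat l s" "W3' \<in> carrier_mat s l" "W4' \<in> carrier_mat s s"
    and GW: "G * four_block_mat W1' W2' W3' W4' = four_block_mat W1 W2 W3 W4 * H"
  shows "det W4 dvd det W4'"
    and "r = s \<Longrightarrow> det D dvd det D'"
    and "\<exists>G1 G2 S. G1 \<in> carrier_mat k l \<and> G2 \<in> carrier_mat k s \<and> S \<in> carrier_mat r s \<and>
      G = four_block_mat G1 G2 (0\<^sub>m r l) S"
    and "r = s \<Longrightarrow> \<exists>R1 R2 R4. R1 \<in> carrier_mat l k \<and> R2 \<in> carrier_mat l r \<and> R4 \<in> carrier_mat s r \<and>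
      R = four_block_mat R1 R2 (0\<^sub>m s k) R4"
proof -
  obtain G1 G2 G3 S where Gc: "G1 \<in> carrier_mat k l" "G2 \<in> carrier_mat k s"
    "G3 \<in> carrier_mat r l" "S \<in> carrier_mat r s" and Gb: "G = four_block_mat G1 G2 G3 S"
    using G by (rule four_block_mat_cases)
  obtain H1 H2 H3 T where Hc: "H1 \<in> carrier_mat k l" "H2 \<in> carrier_mat k s"
    "H3 \<in> carrier_mat r l" "T \<in> carrier_mat r s" and Hb: "H = four_block_mat H1 H2 H3 T"
    using H by (rule four_block_mat_cases)
  obtain R1 R2 R3 R4 where Rc: "R1 \<in> carrier_mat l k" "R2 \<in> carrier_mat l r"
    "R3 \<in> carrier_mat s k" "R4 \<in> carrier_mat s r" and Rb: "R = four_block_mat R1 R2 R3 R4"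
    using R by (rule four_block_mat_cases)
  have "G * four_block_mat D' (0\<^sub>m l s) (0\<^sub>m s l) (0\<^sub>m s s) =
      four_block_mat (G1 * D') (0\<^sub>m k s) (G3 * D') (0\<^sub>m r s)"
    unfolding Gb using Gc D' by (subst mult_four_block_mat[of _ k l _ s _ r _ _ l _ s]) auto
  moreover have "four_block_mat D (0\<^sub>m k r) (0\<^sub>m r k) (0\<^sub>m r r) * H =
      four_block_mat (D * H1) (D * H2) (0\<^sub>m r l) (0\<^sub>m r s)"
    unfolding Hb using Hc D by (subst mult_four_block_mat[of _ k k _ r _ r _ _ l _ s]) auto
  ultimately have "four_block_mat (G1 * D') (0\<^sub>m k s) (G3 * D') (0\<^sub>m r s) =
      four_block_mat (D * H1) (D * H2) (0\<^sub>m r l) (0\<^sub>m r s)" using GD by simp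
  note e = four_block_mat_inject[OF _ _ _ _ _ _ _ _ this, of k l s r]
  have GD1: "G1 * D' = D * H1" and GD2: "D * H2 = 0\<^sub>m k s" and GD3: "G3 * D' = 0\<^sub>m r l"
    using e Gc Hc D D' by auto
  \<comment> \<open>Cancelling the nonsingular \<open>D\<close> and \<open>D'\<close> makes
    \<open>G\<close> preserve the torsion coordinates and \<open>H\<close> the coordinates of the
    kernel.\<close>
  have H2: "H2 = 0\<^sub>m k s" using mat_mult_left_cancel_zero[OF Hc(2) D GD2] .
  have G3: "G3 = 0\<^sub>m r l" using mat_mult_right_cancel_zero[OF Gc(3) D' GD3] .
  show "\<exists>G1 G2 S. G1 \<in> carrier_mat k l \<and> G2 \<in> carrier_mat k s \<and> S \<in> carrier_mat r s \<and>
      G = four_block_mat G1 G2 (0\<^sub>m r l) S"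
    using Gc Gb unfolding G3 by blast
  have "G * four_block_mat W1' W2' W3' W4' =
      four_block_mat (G1 * W1' + G2 * W3') (G1 * W2' + G2 * W4') (S * W3') (S * W4')"
    unfolding Gb G3 using Gc W' by (subst mult_four_block_mat[of _ k l _ s _ r _ _ l _ s]) auto
  moreover have "four_block_mat W1 W2 W3 W4 * H =
      four_block_mat (W1 * H1 + W2 * H3) (W2 * T) (W3 * H1 + W4 * H3) (W4 * T)"
    unfolding Hb H2 using Hc W by (subst mult_four_block_mat[of _ k k _ r _ r _ _ l _ s]) auto
  ultimately have "four_block_mat (G1 * W1' + G2 * W3') (G1 * W2' + G2 * W4') (S * W3') (S * W4') =
      four_block_mat (W1 * H1 + W2 * H3) (W2 * T) (W3 * H1 + W4 * H3) (W4 * T)"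
    using GW by simp
  note e' = four_block_mat_inject[OF _ _ _ _ _ _ _ _ this, of k l s r]
  \<comment> \<open>With \<open>G3\<close> and \<open>H2\<close> gone, the lower right block of
    \<open>GW\<close> involves only \<open>S\<close>, \<open>T\<close>, \<open>W4\<close> and
    \<open>W4'\<close>, and has the shape required by
    \<open>det_dvd_of_intertwining\<close>.\<close>
  have SW: "S * W4' = W4 * T" by (rule e'(4)) (use Gc Hc W W' in auto)
  have "G * R = four_block_mat (G1 * R1 + G2 * R3) (G1 * R2 + G2 * R4) (S * R3) (S * R4)"
    unfolding Gb Rb G3 using Gc Rc by (subst mult_four_block_mat[of _ k l _ s _ r _ _ k _ r]) auto
  then have "four_block_mat (G1 * R1 + G2 * R3) (G1 * R2 + G2 * R4) (S * R3) (S * R4) =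
     four_block_mat (1\<^sub>m k) (0\<^sub>m k r) (0\<^sub>m r k) (1\<^sub>m r)" using GR by simp
  note e'' = four_block_mat_inject[OF _ _ _ _ _ _ _ _ this, of k k r r]
  have GR1: "G1 * R1 + G2 * R3 = 1\<^sub>m k" and SR3: "S * R3 = 0\<^sub>m r k" and SR: "S * R4 = 1\<^sub>m r"
    using e'' Gc Rc by auto
  show "det W4 dvd det W4'"
    by (rule det_dvd_of_intertwining[OF Gc(4) Rc(4) SR W'(4) W(4) Hc(4) SW])
  assume rs: "r = s"
  \<comment> \<open>For \<open>r = s\<close> the right invertible \<open>S\<close> is square, hence
    nonsingular, and \<open>S * R3 = 0\<close> forces \<open>R3 = 0\<close>.\<close>
  have "det S * det R4 = 1" using SR Gc Rc rs by (metis det_mult det_one)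
  then have "det S \<noteq> 0" by auto
  then have R3: "R3 = 0\<^sub>m s k"
    using mat_mult_left_cancel_zero[of R3 s k S] SR3 Gc Rc rs by simp
  then show "\<exists>R1 R2 R4. R1 \<in> carrier_mat l k \<and> R2 \<in> carrier_mat l r \<and> R4 \<in> carrier_mat s r \<and>
      R = four_block_mat R1 R2 (0\<^sub>m s k) R4"
    using Rc Rb by blast
  \<comment> \<open>Now \<open>R1\<close> is a right inverse of \<open>G1\<close>, so
    \<open>GD1\<close> is an intertwining relation for the torsion blocks \<open>D\<close> and
    \<open>D'\<close>.\<close>
  have "G1 * R1 = 1\<^sub>m k" using GR1 Gc Rc unfolding R3 by simp
  then show "det D dvd det D'"
    by (rule det_dvd_of_intertwining[OF Gc(1) Rc(1) _ D'(1) D(1) Hc(1) GD1])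
qed

section \<open>Bowen--Franks groups in coordinates\<close>

lemma comm_group_zvec: "comm_group (zvec V)"
proof (rule comm_groupI)
  fix x assume "x \<in> carrier (zvec V)"
  then show "\<exists>y\<in>carrier (zvec V). y \<otimes>\<^bsub>zvec V\<^esub> x = \<one>\<^bsub>zvec V\<^esub>"
    by (intro bexI[of _ "\<lambda>v. - x v"]) (auto simp: zvec_def)
qed (auto simp: zvec_def add_ac)

lemma inv_zvec:
  assumes "x \<in> carrier (zvec V)" shows "inv\<^bsub>zvec V\<^esub> x = (\<lambda>v. - x v)"
proof -
  interpret comm_group "zvec V" by (rule comm_group_zvec)
  show ?thesis by (rule inv_equality) (use assms in \<open>auto simp: zvec_def\<close>)
qed

lemma zvec_r_coset_eq: "H #>\<^bsub>zvec V\<^esub> x = {z. (\<lambda>v. z v - x v) \<in> H}"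
proof -
  have "z \<in> H #>\<^bsub>zvec V\<^esub> x" if "(\<lambda>v. z v - x v) \<in> H" for z
    using that by (auto simp: r_coset_def zvec_def intro!: bexI[of _ "\<lambda>v. z v - x v"])
  then show ?thesis by (auto simp: r_coset_def zvec_def)
qed

lemma I_minus_A_diff: "I_minus_A X (\<lambda>v. x v - y v) = (\<lambda>v. I_minus_A X x v - I_minus_A X y v)"
  by (auto simp: I_minus_A_def adj_op_def sum_subtractf)

lemma subgroup_BF_sub: "subgroup (BF_sub X) (zvec (verts X))"
proof -
  interpret comm_group "zvec (verts X)" by (rule comm_group_zvec)
  have sub: "BF_sub X \<subseteq> carrier (zvec (verts X))"
    by (auto simp: BF_sub_def zvec_def I_minus_A_def adj_op_def)
  have diff: "(\<lambda>v. x v - y v) \<in> BF_sub X" if xy: "x \<in> BF_sub X" "y \<in> BF_sub X" for x y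
  proof -
    obtain a b where "a \<in> carrier (zvec (verts X))" "x = I_minus_A X a"
        "b \<in> carrier (zvec (verts X))" "y = I_minus_A X b"
      using xy by (auto simp: BF_sub_def)
    then show ?thesis unfolding BF_sub_def
      by (intro image_eqI[of _ _ "\<lambda>v. a v - b v"]) (auto simp: I_minus_A_diff zvec_def)
  qed
  have zero: "(\<lambda>v. 0) \<in> BF_sub X"
    unfolding BF_sub_def
    by (intro image_eqI[of _ _ "\<lambda>v. 0"]) (auto simp: I_minus_A_def adj_op_def zvec_def)
  show "subgroup (BF_sub X) (zvec (verts X))"
  proof (rule subgroupI[OF sub])
    show "BF_sub X \<noteq> {}" using zero by auto
    fix a assume a: "a \<in> BF_sub X"
    show "inv\<^bsub>zvec (verts X)\<^esub> a \<in> BF_sub X"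
      using diff[OF zero a] inv_zvec[of a] sub a by auto
    fix b assume b: "b \<in> BF_sub X"
    show "a \<otimes>\<^bsub>zvec (verts X)\<^esub> b \<in> BF_sub X"
      using diff[OF a diff[OF zero b]] by (simp add: zvec_def)
  qed
qed

lemma comm_group_BF: "comm_group (BF X)"
  unfolding BF_def by (rule comm_group.abelian_FactGroup[OF comm_group_zvec subgroup_BF_sub])

lemma BF_coset_eq_iff:
  assumes "x \<in> carrier (zvec (verts X))" "y \<in> carrier (zvec (verts X))"
  shows "BF_sub X #>\<^bsub>zvec (verts X)\<^esub> x = BF_sub X #>\<^bsub>zvec (verts X)\<^esub> y \<longleftrightarrow>
    (\<lambda>v. x v - y v) \<in> BF_sub X"
proof -
  interpret comm_group "zvec (verts X)" by (rule comm_group_zvec)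
  show ?thesis
  proof
    assume "BF_sub X #>\<^bsub>zvec (verts X)\<^esub> x = BF_sub X #>\<^bsub>zvec (verts X)\<^esub> y"
    then have "x \<in> BF_sub X #>\<^bsub>zvec (verts X)\<^esub> y"
      using rcos_self[OF assms(1) subgroup_BF_sub] by simp
    then show "(\<lambda>v. x v - y v) \<in> BF_sub X" by (simp add: zvec_r_coset_eq)
  next
    assume "(\<lambda>v. x v - y v) \<in> BF_sub X"
    then have "x \<in> BF_sub X #>\<^bsub>zvec (verts X)\<^esub> y" by (simp add: zvec_r_coset_eq)
    from repr_independence[OF this assms(2) subgroup_BF_sub]
    show "BF_sub X #>\<^bsub>zvec (verts X)\<^esub> x = BF_sub X #>\<^bsub>zvec (verts X)\<^esub> y" by simp
  qed
qed

section \<open>Vertex coordinates on a finite digraph\<close>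

locale enumerated_digraph =
  fixes X :: "('v,'e) digraph" and e :: "nat \<Rightarrow> 'v" and n :: nat
  assumes fin: "fin_digraph X" and enum: "bij_betw e {0..<n} (verts X)"
begin

text \<open>Rows are indexed by targets and columns by origins, so that \<open>A\<close> acts on
  column vectors as \<open>adj_op\<close> acts on functions.\<close>

definition A :: "int mat" where
  "A = mat n n (\<lambda>(i,j). Defs.adj_mat X (e i) (e j))"

definition coords :: "('v \<Rightarrow> int) \<Rightarrow> int vec" where
  "coords x = vec n (\<lambda>i. x (e i))"

definition of_coords :: "int vec \<Rightarrow> 'v \<Rightarrow> int" where
  "of_coords v = (\<lambda>x. if x \<in> verts X then v $ inv_into {0..<n} e x else 0)"

lemma A_carrier: "A \<in> carrier_mat n n"
  by (simp add: A_def)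

lemma coords_carrier: "coords x \<in> carrier_vec n"
  by (simp add: coords_def)

lemma e_in: "i < n \<Longrightarrow> e i \<in> verts X"
  using enum by (auto simp: bij_betw_def)

lemma e_inv: "i < n \<Longrightarrow> inv_into {0..<n} e (e i) = i"
  using enum by (auto simp: bij_betw_def)

lemma e_eq_iff: "i < n \<Longrightarrow> j < n \<Longrightarrow> e i = e j \<longleftrightarrow> i = j"
  using e_inv by metis

lemma e_ex: "v \<in> verts X \<Longrightarrow> \<exists>i<n. v = e i"
  using enum unfolding bij_betw_def by (metis atLeastLessThan_iff imageE)

lemma sum_verts: "(\<Sum>v\<in>verts X. F v) = (\<Sum>i = 0..<n. F (e i))"
  using sum.reindex_bij_betw[OF enum, of F] by simp

lemma coords_of_coords: "v \<in> carrier_vec n \<Longrightarrow> coords (of_coords v) = v"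
  by (intro eq_vecI) (auto simp: coords_def of_coords_def e_in e_inv)

lemma of_coords_coords: "x \<in> carrier (zvec (verts X)) \<Longrightarrow> of_coords (coords x) = x"
  using e_ex by (fastforce simp: of_coords_def coords_def zvec_def e_inv intro!: ext)

lemma of_coords_carrier: "of_coords v \<in> carrier (zvec (verts X))"
  by (auto simp: of_coords_def zvec_def)

lemma of_coords_add:
  assumes "u \<in> carrier_vec n" "v \<in> carrier_vec n"
  shows "of_coords (u + v) = of_coords u \<otimes>\<^bsub>zvec (verts X)\<^esub> of_coords v"
proof
  fix x
  show "of_coords (u + v) x = (of_coords u \<otimes>\<^bsub>zvec (verts X)\<^esub> of_coords v) x"
  proof (cases "x \<in> verts X")
    case True
    then obtain i where "i < n" "x = e i" using e_ex by blast
    then show ?thesis using assms by (simp add: of_coords_def zvec_def e_in e_inv)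
  qed (simp add: of_coords_def zvec_def)
qed

text \<open>Grouping the edges that enter a vertex by their origin turns the sum in
  \<open>adj_op\<close> into a row of \<open>A\<close> times the coordinate vector.\<close>

lemma coords_I_minus_A: "coords (I_minus_A X x) = (1\<^sub>m n - A) *\<^sub>v coords x"
proof (rule eq_vecI)
  fix i assume "i < dim_vec ((1\<^sub>m n - A) *\<^sub>v coords x)"
  then have i: "i < n" using A_carrier by simp
  let ?E = "{\<epsilon>\<in>arcs X. targ X \<epsilon> = e i}"
  have fE: "finite ?E" and fV: "finite (verts X)" and o: "orig X ` ?E \<subseteq> verts X"
    using fin by (auto simp: fin_digraph_def)
  have "adj_op X x (e i) = (\<Sum>\<epsilon>\<in>?E. x (orig X \<epsilon>))" using e_in[OF i] by (simp add: adj_op_def)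
  also have "\<dots> = (\<Sum>v\<in>verts X. \<Sum>\<epsilon>\<in>{\<epsilon>\<in>?E. orig X \<epsilon> = v}. x (orig X \<epsilon>))"
    by (rule sum.group[OF fE fV o, symmetric])
  also have "\<dots> = (\<Sum>v\<in>verts X. Defs.adj_mat X (e i) v * x v)"
    by (intro sum.cong refl) (simp add: Defs.adj_mat_def conj_ac)
  also have "\<dots> = (\<Sum>j = 0..<n. Defs.adj_mat X (e i) (e j) * x (e j))" by (rule sum_verts)
  finally have adj: "adj_op X x (e i) = (A *\<^sub>v coords x) $ i"
    using i by (simp add: A_def coords_def scalar_prod_def)
  have "(1\<^sub>m n - A) *\<^sub>v coords x = coords x - A *\<^sub>v coords x"
    using minus_mult_distrib_mat_vec[OF one_carrier_mat A_carrier coords_carrier] coords_carrier by simp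
  then show "coords (I_minus_A X x) $ i = ((1\<^sub>m n - A) *\<^sub>v coords x) $ i"
    using i adj A_carrier by (simp add: coords_def I_minus_A_def)
qed (use A_carrier in \<open>simp add: coords_def\<close>)

lemma BF_sub_iff:
  assumes "x \<in> carrier (zvec (verts X))"
  shows "x \<in> BF_sub X \<longleftrightarrow> (\<exists>z\<in>carrier_vec n. coords x = (1\<^sub>m n - A) *\<^sub>v z)"
proof
  assume "x \<in> BF_sub X"
  then show "\<exists>z\<in>carrier_vec n. coords x = (1\<^sub>m n - A) *\<^sub>v z"
    by (auto simp: BF_sub_def coords_I_minus_A coords_carrier)
next
  assume "\<exists>z\<in>carrier_vec n. coords x = (1\<^sub>m n - A) *\<^sub>v z"
  then obtain z where z: "z \<in> carrier_vec n" "coords x = (1\<^sub>m n - A) *\<^sub>v z" by blast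
  then have "coords (I_minus_A X (of_coords z)) = coords x"
    by (simp add: coords_I_minus_A coords_of_coords)
  moreover have "I_minus_A X (of_coords z) \<in> carrier (zvec (verts X))"
    by (auto simp: zvec_def I_minus_A_def adj_op_def of_coords_def)
  ultimately have "x = I_minus_A X (of_coords z)" using of_coords_coords assms by metis
  then show "x \<in> BF_sub X" using of_coords_carrier by (auto simp: BF_sub_def)
qed

lemma gpoly_eq_det: "gpoly X = det (1\<^sub>m n - [:0, 1:] \<cdot>\<^sub>m map_mat (\<lambda>a. [:a:]) A)"
proof -
  have "mat n n (\<lambda>(i,j). (if e i = e j then 1 else 0) - Polynomial.smult (Defs.adj_mat X (e i) (e j)) [:0, 1:])
      = 1\<^sub>m n - [:0, 1:] \<cdot>\<^sub>m map_mat (\<lambda>a. [:a:]) A"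
    by (intro eq_matI) (auto simp: A_def e_eq_iff)
  then show ?thesis unfolding gpoly_def det_on_eq_det[OF enum] by simp
qed

text \<open>At \<open>u = 0\<close> the matrix is the identity, so the value there is 1. This gives
  the order at 1 its usual meaning.\<close>

lemma gpoly_nonzero: "gpoly X \<noteq> 0"
proof -
  have "poly (gpoly X) 0 = det (map_mat (\<lambda>p. poly p 0) (1\<^sub>m n - [:0, 1:] \<cdot>\<^sub>m map_mat (\<lambda>a. [:a:]) A))"
    unfolding gpoly_eq_det by (simp add: comm_ring_hom.hom_det[OF poly_hom.comm_ring_hom_axioms])
  also have "map_mat (\<lambda>p. poly p 0) (1\<^sub>m n - [:0, 1:] \<cdot>\<^sub>m map_mat (\<lambda>a. [:a:]) A) = 1\<^sub>m n"
    using A_carrier by (intro eq_matI) auto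
  finally show ?thesis by auto
qed

end

text \<open>The block \<open>W4\<close> of \<open>U V\<close> is the matrix of the natural map from the kernel of \<open>1 - A\<close> to its
  cokernel modulo torsion.\<close>

locale diagonalized_digraph = enumerated_digraph X e "k + r"
  for X :: "('v,'e) digraph" and e k r +
  fixes U U' V V' W1 W2 W3 W4 :: "int mat" and d :: "nat \<Rightarrow> int"
  assumes U: "unimodular (k + r) U" and V: "unimodular (k + r) V"
    and U': "U' \<in> carrier_mat (k + r) (k + r)" "U * U' = 1\<^sub>m (k + r)" "U' * U = 1\<^sub>m (k + r)"
    and V': "V' \<in> carrier_mat (k + r) (k + r)" "V * V' = 1\<^sub>m (k + r)" "V' * V = 1\<^sub>m (k + r)"
    and d_nz: "\<And>i. i < k \<Longrightarrow> d i \<noteq> 0"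
    and diag: "U * (1\<^sub>m (k + r) - A) * V = four_block_mat (mat_diag k d) (0\<^sub>m k r) (0\<^sub>m r k) (0\<^sub>m r r)"
    and W: "W1 \<in> carrier_mat k k" "W2 \<in> carrier_mat k r" "W3 \<in> carrier_mat r k" "W4 \<in> carrier_mat r r"
    and UV: "U * V = four_block_mat W1 W2 W3 W4"
begin

abbreviation "n \<equiv> k + r"

definition B :: "int mat" where "B = 1\<^sub>m n - A"

definition D :: "int mat" where
  "D = four_block_mat (mat_diag k d) (0\<^sub>m k r) (0\<^sub>m r k) (0\<^sub>m r r)"

text \<open>The vector \<open>w\<close> lists coordinates in the basis of the target in which
  \<open>1 - A\<close> is diagonal; \<open>U'\<close>, the inverse of \<open>U\<close>, carries them
  back to vertex coordinates.\<close>

definition h :: "int vec \<Rightarrow> ('v \<Rightarrow> int) set" where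
  "h w = BF_sub X #>\<^bsub>zvec (verts X)\<^esub> of_coords (U' *\<^sub>v w)"

lemma carriers: "U \<in> carrier_mat n n" "V \<in> carrier_mat n n" "B \<in> carrier_mat n n" "D \<in> carrier_mat n n"
  using U V A_carrier by (auto simp: unimodular_def B_def D_def)

lemma UBV: "U * B * V = D"
  using diag by (simp add: B_def D_def)

lemma UB: "U * B = D * V'"
proof -
  have "D * V' = U * B * (V * V')"
    unfolding UBV[symmetric] using carriers V' by (intro assoc_mult_mat[of _ n n _ n _ n]) auto
  then show ?thesis using V' carriers by simp
qed

lemma BV: "B * V = U' * D"
proof -
  have "U' * D = U' * (U * (B * V))"
    unfolding UBV[symmetric] using carriers by (simp add: assoc_mult_mat[of _ n n _ n _ n])
  also have "\<dots> = (U' * U) * (B * V)"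
    using carriers U' by (intro assoc_mult_mat[of _ n n _ n _ n, symmetric]) auto
  finally show ?thesis using U' carriers by simp
qed

lemma D_mult_vec: "y \<in> carrier_vec n \<Longrightarrow> D *\<^sub>v y = vec n (\<lambda>i. (if i < k then d i else 0) * y $ i)"
proof (rule eq_vecI)
  fix i assume y: "y \<in> carrier_vec n" and "i < dim_vec (vec n (\<lambda>i. (if i < k then d i else 0) * y $ i))"
  then have i: "i < n" by simp
  have "(D *\<^sub>v y) $ i = (\<Sum>j = 0..<n. D $$ (i,j) * y $ j)"
    using i y carriers by (simp add: scalar_prod_def)
  also have "\<dots> = (\<Sum>j = 0..<n. if j = i then (if i < k then d i else 0) * y $ i else 0)"
    using i by (intro sum.cong) (auto simp: D_def mat_diag_def)
  finally show "(D *\<^sub>v y) $ i = vec n (\<lambda>i. (if i < k then d i else 0) * y $ i) $ i"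
    using i by simp
qed (use carriers in auto)

text \<open>The relations \<open>UB\<close> and \<open>BV\<close> translate the image of
  \<open>B\<close> into the image of \<open>D\<close>, where membership is divisibility in each
  coordinate; the modulus 0 makes the last \<open>r\<close> coordinates vanish.\<close>

lemma image_B_iff:
  assumes w: "w \<in> carrier_vec n"
  shows "(\<exists>z\<in>carrier_vec n. U' *\<^sub>v w = B *\<^sub>v z) \<longleftrightarrow> (\<forall>i<n. (if i < k then d i else 0) dvd w $ i)"
proof
  assume "\<exists>z\<in>carrier_vec n. U' *\<^sub>v w = B *\<^sub>v z"
  then obtain z where z: "z \<in> carrier_vec n" "U' *\<^sub>v w = B *\<^sub>v z" by blast
  have "w = U * U' *\<^sub>v w" using U' w by simp
  also have "\<dots> = U *\<^sub>v (B *\<^sub>v z)"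
    using assoc_mult_mat_vec[OF carriers(1) U'(1) w] z by simp
  also have "\<dots> = D * V' *\<^sub>v z"
    unfolding UB[symmetric] using assoc_mult_mat_vec[OF carriers(1,3) z(1)] by simp
  also have "\<dots> = D *\<^sub>v (V' *\<^sub>v z)" by (rule assoc_mult_mat_vec[OF carriers(4) V'(1) z(1)])
  finally have wD: "w = D *\<^sub>v (V' *\<^sub>v z)" .
  have Vz: "V' *\<^sub>v z \<in> carrier_vec n" using V' z by simp
  show "\<forall>i<n. (if i < k then d i else 0) dvd w $ i"
  proof (intro allI impI)
    fix i assume "i < n"
    then have "w $ i = (if i < k then d i else 0) * (V' *\<^sub>v z) $ i"
      unfolding wD[THEN arg_cong[of _ _ "\<lambda>v. v $ i"]] D_mult_vec[OF Vz] by (rule index_vec)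
    then show "(if i < k then d i else 0) dvd w $ i" by (simp only: dvd_triv_left)
  qed
next
  assume dvd: "\<forall>i<n. (if i < k then d i else 0) dvd w $ i"
  \<comment> \<open>For \<open>i\<close> from \<open>k\<close> on the divisor is 0 and
    \<open>div\<close> returns 0; the entry of \<open>w\<close> is 0 there as well, so
    \<open>D *\<^sub>v y = w\<close> still holds.\<close>
  define y where "y = vec n (\<lambda>i. w $ i div (if i < k then d i else 0))"
  have y: "y \<in> carrier_vec n" by (simp add: y_def)
  have "D *\<^sub>v y = w" unfolding D_mult_vec[OF y] using w dvd
    by (intro eq_vecI) (auto simp: y_def)
  then have "U' *\<^sub>v w = U' * D *\<^sub>v y" using assoc_mult_mat_vec[OF U'(1) carriers(4) y] by simp
  also have "\<dots> = B *\<^sub>v (V *\<^sub>v y)"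
    unfolding BV[symmetric] by (rule assoc_mult_mat_vec[OF carriers(3,2) y])
  finally show "\<exists>z\<in>carrier_vec n. U' *\<^sub>v w = B *\<^sub>v z" using y carriers by auto
qed

sublocale presentation: diagonal_presentation "BF X" h n k d
proof (intro diagonal_presentation.intro comm_group_BF diagonal_presentation_axioms.intro)
  interpret Z: comm_group "zvec (verts X)" by (rule comm_group_zvec)
  interpret N: normal "BF_sub X" "zvec (verts X)"
    by (rule Z.subgroup_imp_normal[OF subgroup_BF_sub])
  show "k \<le> n" by simp
  show "\<And>i. i < k \<Longrightarrow> d i \<noteq> 0" by (rule d_nz)
  show "h ` carrier_vec n = carrier (BF X)"
  proof
    show "h ` carrier_vec n \<subseteq> carrier (BF X)"
      using of_coords_carrier by (auto simp: BF_def carrier_FactGroup h_def)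
    show "carrier (BF X) \<subseteq> h ` carrier_vec n"
    proof
      fix C assume "C \<in> carrier (BF X)"
      then obtain x where x: "x \<in> carrier (zvec (verts X))" "C = BF_sub X #>\<^bsub>zvec (verts X)\<^esub> x"
        by (auto simp: BF_def carrier_FactGroup)
      have "U' *\<^sub>v (U *\<^sub>v coords x) = coords x"
        using assoc_mult_mat_vec[OF U'(1) carriers(1) coords_carrier[of x]] U' coords_carrier by simp
      then have "h (U *\<^sub>v coords x) = C" using x by (simp add: h_def of_coords_coords)
      then show "C \<in> h ` carrier_vec n" using carriers coords_carrier by auto
    qed
  qed
  fix u v :: "int vec" assume uv: "u \<in> carrier_vec n" "v \<in> carrier_vec n"
  have U'uv: "U' *\<^sub>v u \<in> carrier_vec n" "U' *\<^sub>v v \<in> carrier_vec n" using U' uv by auto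
  show "h (u + v) = h u \<otimes>\<^bsub>BF X\<^esub> h v"
    unfolding h_def BF_def mult_FactGroup N.rcos_sum[OF of_coords_carrier of_coords_carrier]
    using mult_add_distrib_mat_vec[OF U'(1) uv] of_coords_add[OF U'uv] by simp
  have sub: "(\<lambda>x. of_coords (U' *\<^sub>v u) x - of_coords (U' *\<^sub>v v) x) = of_coords (U' *\<^sub>v (u - v))"
  proof
    fix x
    show "of_coords (U' *\<^sub>v u) x - of_coords (U' *\<^sub>v v) x = of_coords (U' *\<^sub>v (u - v)) x"
    proof (cases "x \<in> verts X")
      case True
      then obtain i where "i < n" "x = e i" using e_ex by blast
      then show ?thesis using U'uv U' mult_minus_distrib_mat_vec[OF U'(1) uv]
        by (simp add: of_coords_def e_in e_inv)
    qed (simp add: of_coords_def)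
  qed
  have "h u = h v \<longleftrightarrow> of_coords (U' *\<^sub>v (u - v)) \<in> BF_sub X"
    unfolding h_def BF_coset_eq_iff[OF of_coords_carrier of_coords_carrier] sub ..
  also have "\<dots> \<longleftrightarrow> (\<exists>z\<in>carrier_vec n. U' *\<^sub>v (u - v) = B *\<^sub>v z)"
    using BF_sub_iff[OF of_coords_carrier] coords_of_coords[of "U' *\<^sub>v (u - v)"] U' uv
    by (simp add: B_def)
  also have "\<dots> \<longleftrightarrow> (\<forall>i<n. (if i < k then d i else 0) dvd (u - v) $ i)"
    by (rule image_B_iff) (use uv in auto)
  also have "\<dots> \<longleftrightarrow> (\<forall>i<n. (if i < k then d i else 0) dvd u $ i - v $ i)"
    using uv by simp
  finally show "h u = h v \<longleftrightarrow> (\<forall>i<n. (if i < k then d i else 0) dvd u $ i - v $ i)" .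
qed

section \<open>Torsion order and m(X) read off from the diagonal form\<close>

lemma det_D1: "det (mat_diag k d) = (\<Prod>i<k. d i)"
proof -
  have "det (mat_diag k d) = prod_list (diag_mat (mat_diag k d))"
    by (rule det_upper_triangular[of _ k]) (auto simp: mat_diag_def upper_triangular_def)
  also have "\<dots> = (\<Prod>i = 0..<k. d i)"
    unfolding prod_list_diag_prod by (auto simp: mat_diag_def intro!: prod.cong)
  finally show ?thesis by (simp add: atLeast0LessThan)
qed

lemma det_D1_nonzero: "det (mat_diag k d) \<noteq> 0"
  using d_nz by (simp add: det_D1)

lemma card_tors_BF: "int (card (tors (BF X))) = \<bar>det (mat_diag k d)\<bar>"
  using presentation.card_tors by (simp add: det_D1)

lemma delta_zero:
  assumes "delta X = 0"
  shows "r_ord X = r" and "\<bar>mX X\<bar> = \<bar>det W4\<bar>"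
proof -
  show r: "r_ord X = r"
    using assms presentation.Z_rank_eq by (simp add: delta_def)
  obtain q where q: "gpoly X = [:-1, 1:] ^ r * q" and q1: "\<bar>poly q 1\<bar> = \<bar>det (mat_diag k d) * det W4\<bar>"
    using det_one_minus_u_factor[OF A_carrier U V mat_diag_dim diag W UV] unfolding gpoly_eq_det by metis
  have "q \<noteq> 0" using q gpoly_nonzero by auto
  \<comment> \<open>In general the order at 1 exceeds the rank \<open>r\<close> by the order of
    \<open>q\<close>. The assumption \<open>delta X = 0\<close> makes them equal, so
    \<open>q\<close> does not vanish at 1 and its value there is \<open>gstar X\<close>.\<close>
  have "Polynomial.order 1 (gpoly X) = r + Polynomial.order 1 q"
    using order_mult[of "[:-1, 1:] ^ r" q 1] gpoly_nonzero order_power_n_n[of "1::int" r] by (simp add: q)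
  then have "poly q 1 \<noteq> 0" using r \<open>q \<noteq> 0\<close> by (simp add: r_ord_def order_root)
  then have "gstar X = poly q 1"
    unfolding gstar_def r unfolding q by (rule order_and_leading_taylor_coeff)
  then have gs: "gstar X \<noteq> 0" "\<bar>gstar X\<bar> = int (card (tors (BF X))) * \<bar>det W4\<bar>"
    using q1 \<open>poly q 1 \<noteq> 0\<close> by (auto simp: card_tors_BF abs_mult)
  \<comment> \<open>The sign of \<open>gstar X\<close> is put into \<open>m\<close>. The torsion
    order is nonzero because \<open>gstar X\<close> is, so the description in \<open>mX_def\<close>
    has a unique solution.\<close>
  define m where "m = sgn (gstar X) * \<bar>det W4\<bar>"
  have m: "gstar X = m * int (card (tors (BF X)))"
    using gs(2) by (metis m_def mult.assoc mult.commute sgn_mult_abs)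
  have "mX X = m" unfolding mX_def
  proof (rule the_equality)
    show "m \<noteq> 0 \<and> gstar X = m * int (card (tors (BF X)))" using gs m by auto
    fix m' assume "m' \<noteq> 0 \<and> gstar X = m' * int (card (tors (BF X)))"
    then show "m' = m" using gs m by auto
  qed
  then show "\<bar>mX X\<bar> = \<bar>det W4\<bar>" using gs(1) by (simp add: m_def abs_mult)
qed

end

lemma diagonalized_digraph_exists:
  assumes fin: "fin_digraph X"
  obtains e k r U U' V V' W1 W2 W3 W4 d where "diagonalized_digraph X e k r U U' V V' W1 W2 W3 W4 d"
proof -
  define n where "n = card (verts X)"
  have "finite (verts X)" using fin by (simp add: fin_digraph_def)
  then obtain e where e: "bij_betw e {0..<n} (verts X)" unfolding n_def
    using ex_bij_betw_nat_finite by blast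
  interpret enumerated_digraph X e n using fin e by unfold_locales
  have "1\<^sub>m n - A \<in> carrier_mat n n" using A_carrier by auto
  then obtain k d where k: "k \<le> n" and d: "\<And>i. i < k \<Longrightarrow> d i \<noteq> 0"
    and eq: "unimod_equiv n n (1\<^sub>m n - A) (mat n n (\<lambda>(i,j). if i = j \<and> i < k then d i else 0))"
    using unimod_equiv_diagonal by blast
  obtain r where n: "n = k + r" using k by (metis le_iff_add)
  obtain U V where UV: "unimodular n U" "unimodular n V"
    and diag: "mat n n (\<lambda>(i,j). if i = j \<and> i < k then d i else 0) = U * (1\<^sub>m n - A) * V"
    using eq unfolding unimod_equiv_def by blast
  have diag': "mat n n (\<lambda>(i,j). if i = j \<and> i < k then d i else 0) =
      four_block_mat (mat_diag k d) (0\<^sub>m k r) (0\<^sub>m r k) (0\<^sub>m r r)"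
    unfolding n by (intro eq_matI) (auto simp: mat_diag_def)
  obtain U' where U': "U' \<in> carrier_mat n n" "U * U' = 1\<^sub>m n" "U' * U = 1\<^sub>m n"
    using unimodular_inverse[OF UV(1)] .
  obtain V' where V': "V' \<in> carrier_mat n n" "V * V' = 1\<^sub>m n" "V' * V = 1\<^sub>m n"
    using unimodular_inverse[OF UV(2)] .
  have "U * V \<in> carrier_mat (k + r) (k + r)" using UV n by (auto simp: unimodular_def)
  then obtain W1 W2 W3 W4 where W: "W1 \<in> carrier_mat k k" "W2 \<in> carrier_mat k r"
    "W3 \<in> carrier_mat r k" "W4 \<in> carrier_mat r r" "U * V = four_block_mat W1 W2 W3 W4"
    by (rule four_block_mat_cases)
  have "diagonalized_digraph X e k r U U' V V' W1 W2 W3 W4 d"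
    by (intro diagonalized_digraph.intro enumerated_digraph.intro diagonalized_digraph_axioms.intro
      fin e[unfolded n] UV[unfolded n] U'[unfolded n] V'[unfolded n] d W
      trans[OF diag[symmetric] diag', unfolded n])
  then show thesis by (rule that)
qed

section \<open>Covers\<close>

lemma mult_assoc_dim:
  fixes P Q R :: "'a :: semiring_0 mat"
  shows "dim_col P = dim_row Q \<Longrightarrow> dim_col Q = dim_row R \<Longrightarrow> P * Q * R = P * (Q * R)"
  by (rule assoc_mult_mat[of _ "dim_row P" "dim_col P" _ "dim_col Q" _ "dim_col R"]) auto

text \<open>In a lower row the first \<open>l\<close> matrix entries are 0, and the remaining
  entries meet zeros of \<open>u\<close>. Thus block triangular matrices carry vectors supported on
  torsion coordinates to vectors of the same kind.\<close>

lemma block_upper_mult_vec_zero: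
  fixes P :: "'a :: semiring_0 mat"
  assumes "P \<in> carrier_mat k l" "Q \<in> carrier_mat k s" "S \<in> carrier_mat r s"
    and u: "u \<in> carrier_vec (l + s)" "\<And>j. j < l + s \<Longrightarrow> l \<le> j \<Longrightarrow> u $ j = 0"
    and i: "i < k + r" "k \<le> i"
  shows "(four_block_mat P Q (0\<^sub>m r l) S *\<^sub>v u) $ i = 0"
proof -
  let ?M = "four_block_mat P Q (0\<^sub>m r l) S"
  have "(?M *\<^sub>v u) $ i = (\<Sum>j = 0..<l + s. ?M $$ (i,j) * u $ j)"
    using assms by (simp add: scalar_prod_def)
  also have "\<dots> = 0"
  proof (rule sum.neutral, rule ballI)
    fix j assume "j \<in> {0..<l + s}"
    then show "?M $$ (i,j) * u $ j = 0" using assms by (cases "j < l") auto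
  qed
  finally show ?thesis .
qed

section \<open>The push-forward matrix of a cover\<close>

locale enumerated_cover = X: enumerated_digraph X e n + Y: enumerated_digraph Y e' n'
  for X :: "('v,'e) digraph" and e n and Y :: "('w,'d) digraph" and e' n' +
  fixes fV :: "'w \<Rightarrow> 'v" and fE :: "'d \<Rightarrow> 'e"
  assumes cover: "is_cover Y X fV fE"
begin

definition F :: "int mat" where
  "F = mat n n' (\<lambda>(i,j). if fV (e' j) = e i then 1 else 0)"

abbreviation push :: "('w \<Rightarrow> int) \<Rightarrow> 'v \<Rightarrow> int" where
  "push \<equiv> pushfwd fV (verts Y) (verts X)"

lemma F_carrier: "F \<in> carrier_mat n n'"
  by (simp add: F_def)

lemma fV_in: "w \<in> verts Y \<Longrightarrow> fV w \<in> verts X"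
  using cover by (auto simp: is_cover_def digraph_morphism_def)

lemma coords_push: "X.coords (push y) = F *\<^sub>v Y.coords y"
proof (rule eq_vecI)
  fix i assume "i < dim_vec (F *\<^sub>v Y.coords y)"
  then have i: "i < n" using F_carrier by simp
  have fin: "finite (verts Y)" using Y.fin by (simp add: fin_digraph_def)
  have "push y (e i) = (\<Sum>w\<in>{w\<in>verts Y. fV w = e i}. y w)"
    using X.e_in[OF i] by (simp add: pushfwd_def)
  also have "\<dots> = (\<Sum>w\<in>verts Y. if fV w = e i then y w else 0)"
    using fin by (simp add: sum.inter_filter)
  also have "\<dots> = (\<Sum>j = 0..<n'. if fV (e' j) = e i then y (e' j) else 0)" by (rule Y.sum_verts)
  also have "\<dots> = (F *\<^sub>v Y.coords y) $ i"
    using i by (auto simp: F_def Y.coords_def scalar_prod_def intro!: sum.cong)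
  finally show "X.coords (push y) $ i = (F *\<^sub>v Y.coords y) $ i" using i by (simp add: X.coords_def)
qed (use F_carrier in \<open>simp add: X.coords_def\<close>)

text \<open>Both entries count the edges of \<open>X\<close> from \<open>fV (e' j)\<close> to
  \<open>e i\<close>: on the left through their lifts starting at \<open>e' j\<close>, which the
  cover puts in bijection with the edges leaving \<open>fV (e' j)\<close>.\<close>

lemma F_intertwines: "F * Y.A = X.A * F"
proof (rule eq_matI)
  fix i j assume "i < dim_row (X.A * F)" "j < dim_col (X.A * F)"
  then have i: "i < n" and j: "j < n'" using F_carrier X.A_carrier by auto
  let ?O = "{\<epsilon>\<in>arcs Y. orig Y \<epsilon> = e' j}" and ?P = "{\<epsilon>\<in>arcs X. orig X \<epsilon> = fV (e' j)}"
  have finY: "finite (arcs Y)" "finite (verts Y)" and tY: "targ Y ` arcs Y \<subseteq> verts Y"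
    using Y.fin by (auto simp: fin_digraph_def)
  have bij: "bij_betw fE ?O ?P" using cover Y.e_in[OF j] by (simp add: is_cover_def)
  have "(F * Y.A) $$ (i,j) = (\<Sum>l = 0..<n'. if fV (e' l) = e i then Defs.adj_mat Y (e' l) (e' j) else 0)"
    using i j by (auto simp: F_def Y.A_def scalar_prod_def intro!: sum.cong)
  also have "\<dots> = (\<Sum>w\<in>verts Y. if fV w = e i then Defs.adj_mat Y w (e' j) else 0)"
    by (rule Y.sum_verts[symmetric])
  also have "\<dots> = (\<Sum>w\<in>verts Y. \<Sum>\<epsilon>\<in>{\<epsilon>\<in>?O. targ Y \<epsilon> = w}. if fV (targ Y \<epsilon>) = e i then 1 else 0)"
    by (intro sum.cong refl) (simp add: Defs.adj_mat_def conj_ac)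
  also have "\<dots> = (\<Sum>\<epsilon>\<in>?O. if fV (targ Y \<epsilon>) = e i then 1 else 0)"
    by (rule sum.group) (use finY tY in auto)
  also have "\<dots> = (\<Sum>\<epsilon>\<in>?O. if targ X (fE \<epsilon>) = e i then 1 else 0)"
    using cover by (intro sum.cong) (auto simp: is_cover_def digraph_morphism_def)
  also have "\<dots> = (\<Sum>\<epsilon>\<in>?P. if targ X \<epsilon> = e i then 1 else 0)"
    by (rule sum.reindex_bij_betw[OF bij])
  also have "\<dots> = Defs.adj_mat X (e i) (fV (e' j))"
    using X.fin by (simp add: fin_digraph_def Defs.adj_mat_def sum.inter_filter[symmetric] conj_ac)
  also have "\<dots> = (\<Sum>v\<in>verts X. if fV (e' j) = v then Defs.adj_mat X (e i) v else 0)"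
    using X.fin fV_in[OF Y.e_in[OF j]] by (simp add: fin_digraph_def)
  also have "\<dots> = (\<Sum>l = 0..<n. if fV (e' j) = e l then Defs.adj_mat X (e i) (e l) else 0)"
    by (rule X.sum_verts)
  also have "\<dots> = (X.A * F) $$ (i,j)"
    using i j by (auto simp: F_def X.A_def scalar_prod_def intro!: sum.cong)
  finally show "(F * Y.A) $$ (i,j) = (X.A * F) $$ (i,j)" .
qed (use F_carrier X.A_carrier Y.A_carrier in auto)

text \<open>Surjectivity on vertices gives a section \<open>s\<close>, and its 0-1 matrix is the
  right inverse.\<close>

lemma F_right_inverse: obtains R where "R \<in> carrier_mat n' n" "F * R = 1\<^sub>m n"
proof -
  have "\<exists>j<n'. fV (e' j) = e i" if "i < n" for i
  proof -
    have "e i \<in> fV ` verts Y" using cover X.e_in[OF that] by (simp add: is_cover_def)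
    then show ?thesis using Y.e_ex by fastforce
  qed
  then obtain s where s: "\<And>i. i < n \<Longrightarrow> s i < n'" "\<And>i. i < n \<Longrightarrow> fV (e' (s i)) = e i" by metis
  define R where "R = mat n' n (\<lambda>(j,i). if j = s i then 1 else (0::int))"
  have "F * R = 1\<^sub>m n"
  proof (rule eq_matI)
    fix i j assume "i < dim_row (1\<^sub>m n :: int mat)" "j < dim_col (1\<^sub>m n :: int mat)"
    then have ij: "i < n" "j < n" by auto
    have "(F * R) $$ (i,j) = (\<Sum>l = 0..<n'. F $$ (i,l) * R $$ (l,j))"
      using ij F_carrier by (simp add: R_def scalar_prod_def)
    also have "\<dots> = (\<Sum>l = 0..<n'. if l = s j then F $$ (i, s j) else 0)"
      using ij by (intro sum.cong) (auto simp: R_def)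
    also have "\<dots> = F $$ (i, s j)" using s(1)[OF ij(2)] by simp
    also have "\<dots> = 1\<^sub>m n $$ (i,j)" using ij s by (auto simp: F_def X.e_eq_iff)
    finally show "(F * R) $$ (i,j) = 1\<^sub>m n $$ (i,j)" .
  qed (auto simp: F_def R_def)
  then show thesis by (intro that[of R]) (auto simp: R_def)
qed

text \<open>This is \<open>det_dvd_of_intertwining\<close> over the polynomial ring: the lifted
  \<open>F\<close> is right invertible and intertwines \<open>1 - u A\<close> for \<open>Y\<close>
  with \<open>1 - u A\<close> for \<open>X\<close>.\<close>

lemma gpoly_dvd: "gpoly X dvd gpoly Y"
proof -
  interpret lift: comm_ring_hom "\<lambda>a::int. [:a:]" by unfold_locales (auto simp: one_pCons)
  let ?L = "map_mat (\<lambda>a::int. [:a:])" and ?u = "[:0, 1:] :: int poly"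
  obtain R where R: "R \<in> carrier_mat n' n" "F * R = 1\<^sub>m n" by (rule F_right_inverse)
  note c = F_carrier X.A_carrier Y.A_carrier
  have "?L F * (1\<^sub>m n' - ?u \<cdot>\<^sub>m ?L Y.A) = ?L F - ?u \<cdot>\<^sub>m (?L F * ?L Y.A)"
    using c by (subst mult_minus_distrib_mat[of _ n n' _ n']) (auto simp: mult_smult_distrib[of _ n n' _ n'])
  also have "?L F * ?L Y.A = ?L X.A * ?L F"
    using c by (metis F_intertwines lift.mat_hom_mult)
  also have "?L F - ?u \<cdot>\<^sub>m (?L X.A * ?L F) = (1\<^sub>m n - ?u \<cdot>\<^sub>m ?L X.A) * ?L F"
    using c by (subst minus_mult_distrib_mat[of _ n n _ _ n']) (auto simp: mult_smult_assoc_mat[of _ n n _ n'])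
  finally have i: "?L F * (1\<^sub>m n' - ?u \<cdot>\<^sub>m ?L Y.A) = (1\<^sub>m n - ?u \<cdot>\<^sub>m ?L X.A) * ?L F" .
  have inv: "?L F * ?L R = 1\<^sub>m n"
    using lift.mat_hom_mult[OF F_carrier R(1)] R(2) lift.mat_hom_one[of n] by simp
  show ?thesis
    unfolding X.gpoly_eq_det Y.gpoly_eq_det
    by (rule det_dvd_of_intertwining[OF _ _ inv _ _ _ i]) (use c R in \<open>auto intro!: minus_carrier_mat\<close>)
qed

text \<open>Splitting the powers of \<open>u - 1\<close> off \<open>gpoly X\<close> and off the
  cofactor \<open>g\<close> shows that leading Taylor coefficients at 1 multiply; the cofactor
  contributes the integer \<open>poly q 1\<close>.\<close>

lemma gstar_dvd: "gstar X dvd gstar Y"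
proof -
  obtain g where g: "gpoly Y = gpoly X * g" using gpoly_dvd by blast
  then have nz: "gpoly X \<noteq> 0" "g \<noteq> 0" using Y.gpoly_nonzero by auto
  obtain p where p: "gpoly X = [:-1, 1:] ^ r_ord X * p" "poly p 1 \<noteq> 0"
    using order_decomp[OF nz(1), of 1] by (auto simp: r_ord_def poly_eq_0_iff_dvd)
  obtain q s where q: "g = [:-1, 1:] ^ s * q" "poly q 1 \<noteq> 0"
    using order_decomp[OF nz(2), of 1] by (auto simp: poly_eq_0_iff_dvd)
  have gY: "gpoly Y = [:-1, 1:] ^ (r_ord X + s) * (p * q)"
    unfolding g p(1) q(1) by (simp only: power_add ac_simps)
  have pq: "poly (p * q) 1 \<noteq> 0" using p q by simp
  have "r_ord Y = r_ord X + s"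
    unfolding r_ord_def[of Y] gY using order_and_leading_taylor_coeff(1)[OF pq] .
  then have "gstar Y = poly p 1 * poly q 1"
    unfolding gstar_def[of Y] using order_and_leading_taylor_coeff(2)[OF pq, of "r_ord X + s"] gY by simp
  moreover have "gstar X = poly p 1"
    unfolding gstar_def using order_and_leading_taylor_coeff(2)[OF p(2), of "r_ord X"] p(1) by metis
  ultimately show ?thesis by simp
qed

section \<open>The induced morphism of Bowen-Franks groups\<close>

lemma push_carrier: "push y \<in> carrier (zvec (verts X))"
  by (auto simp: pushfwd_def zvec_def)

lemma push_diff: "push (\<lambda>w. x w - y w) = (\<lambda>v. push x v - push y v)"
  by (auto simp: pushfwd_def sum_subtractf)

lemma F_intertwines': "F * (1\<^sub>m n' - Y.A) = (1\<^sub>m n - X.A) * F"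
  using F_carrier X.A_carrier Y.A_carrier F_intertwines
  by (simp add: mult_minus_distrib_mat[of _ n n' _ n'] minus_mult_distrib_mat[of _ n n _ _ n'])

lemma push_BF_sub:
  assumes "y \<in> BF_sub Y" shows "push y \<in> BF_sub X"
proof -
  have yc: "y \<in> carrier (zvec (verts Y))"
    using assms by (auto simp: BF_sub_def zvec_def I_minus_A_def adj_op_def)
  then obtain z where z: "z \<in> carrier_vec n'" "Y.coords y = (1\<^sub>m n' - Y.A) *\<^sub>v z"
    using assms Y.BF_sub_iff by blast
  have "X.coords (push y) = F * (1\<^sub>m n' - Y.A) *\<^sub>v z"
    unfolding coords_push z(2) using F_carrier Y.A_carrier z(1)
    by (intro assoc_mult_mat_vec[symmetric]) (auto intro!: minus_carrier_mat)
  also have "\<dots> = (1\<^sub>m n - X.A) *\<^sub>v (F *\<^sub>v z)"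
    unfolding F_intertwines' using F_carrier X.A_carrier z(1)
    by (intro assoc_mult_mat_vec) (auto intro!: minus_carrier_mat)
  finally show ?thesis
    unfolding X.BF_sub_iff[OF push_carrier] using F_carrier z(1) by auto
qed

text \<open>By \<open>push_BF_sub\<close> the push-forward of a coset stays inside the coset of
  \<open>push y\<close>, and the product with \<open>BF_sub X\<close> fills it up to that whole
  coset.\<close>

lemma BF_map_coset:
  "BF_map Y X fV (BF_sub Y #>\<^bsub>zvec (verts Y)\<^esub> y) = BF_sub X #>\<^bsub>zvec (verts X)\<^esub> push y"
  (is "?L = ?R")
proof
  have zero: "(\<lambda>w. 0) \<in> BF_sub Y"
    using subgroup.one_closed[OF subgroup_BF_sub, of Y] by (simp add: zvec_def)
  show "?L \<subseteq> ?R"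
  proof
    fix z assume "z \<in> ?L"
    then obtain a b where a: "a \<in> BF_sub X" and b: "(\<lambda>w. b w - y w) \<in> BF_sub Y"
      and z: "z = (\<lambda>v. a v + push b v)"
      by (auto simp: BF_map_def set_mult_def zvec_r_coset_eq) (auto simp: zvec_def)
    have "(\<lambda>v. push b v - push y v) \<in> BF_sub X" using push_BF_sub[OF b] by (simp add: push_diff)
    from subgroup.m_closed[OF subgroup_BF_sub a this]
    have "(\<lambda>v. z v - push y v) \<in> BF_sub X" by (simp add: z zvec_def add_diff_eq)
    then show "z \<in> ?R" by (simp add: zvec_r_coset_eq)
  qed
  show "?R \<subseteq> ?L"
  proof
    fix z assume "z \<in> ?R"
    then have z: "(\<lambda>v. z v - push y v) \<in> BF_sub X" by (simp add: zvec_r_coset_eq)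
    have "push y \<in> push ` (BF_sub Y #>\<^bsub>zvec (verts Y)\<^esub> y)" using zero by (auto simp: zvec_r_coset_eq)
    moreover have "z = (\<lambda>v. z v - push y v) \<otimes>\<^bsub>zvec (verts X)\<^esub> push y" by (simp add: zvec_def)
    ultimately show "z \<in> ?L" unfolding BF_map_def set_mult_def using z by blast
  qed
qed

end

section \<open>Comparison of the two digraphs in diagonalising coordinates\<close>

theorem theorem2p14:
  fixes X :: "('v,'e) digraph" and Y :: "('w,'d) digraph"
    and fV :: "'w \<Rightarrow> 'v" and fE :: "'d \<Rightarrow> 'e"
  assumes "fin_digraph X" and "fin_digraph Y"
    and "strongly_connected X" and "strongly_connected Y"
    and "is_cover Y X fV fE"
  shows "gstar X dvd gstar Y \<and>
         (delta X = 0 \<and> delta Y = 0 \<longrightarrow> mX X dvd mX Y) \<and>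
         (delta X = 0 \<and> delta Y = 0 \<and> r_ord X = r_ord Y \<longrightarrow>
            BF_map Y X fV ` tors (BF Y) = tors (BF X) \<and>
            card (tors (BF X)) dvd card (tors (BF Y)))"
proof -
  obtain e k r U U' V V' W1 W2 W3 W4 d where "diagonalized_digraph X e k r U U' V V' W1 W2 W3 W4 d"
    using diagonalized_digraph_exists[OF assms(1)] .
  then interpret X: diagonalized_digraph X e k r U U' V V' W1 W2 W3 W4 d .
  obtain f l s P P' Q Q' Z1 Z2 Z3 Z4 c where "diagonalized_digraph Y f l s P P' Q Q' Z1 Z2 Z3 Z4 c"
    using diagonalized_digraph_exists[OF assms(2)] .
  then interpret Y: diagonalized_digraph Y f l s P P' Q Q' Z1 Z2 Z3 Z4 c .
  interpret C: enumerated_cover X e "k + r" Y f "l + s" fV fE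
    by unfold_locales (rule assms(5))
  let ?F = "C.F"
  obtain R where R: "R \<in> carrier_mat (l + s) (k + r)" "?F * R = 1\<^sub>m (k + r)"
    by (rule C.F_right_inverse)
  \<comment> \<open>\<open>G\<close> is the push-forward in the target coordinates given by
    \<open>U\<close> and \<open>P\<close>, \<open>H\<close> is the push-forward in the domain
    coordinates given by \<open>V\<close> and \<open>Q\<close>, and \<open>T\<close> is the right
    inverse \<open>R\<close> in target coordinates.\<close>
  define G where "G = U * ?F * P'"
  define H where "H = V' * ?F * Q"
  define T where "T = P * R * U'"
  note car = C.F_carrier R(1) X.carriers X.U'(1) X.V'(1) Y.carriers Y.U'(1) Y.V'(1)
  note dims = car[THEN carrier_matD(1)] car[THEN carrier_matD(2)]
  have GHT: "G \<in> carrier_mat (k + r) (l + s)" "H \<in> carrier_mat (k + r) (l + s)" "T \<in> carrier_mat (l + s) (k + r)"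
    using car by (auto simp: G_def H_def T_def)
  have FB: "?F * Y.B = X.B * ?F" using C.F_intertwines' by (simp add: X.B_def Y.B_def)
  have GT: "G * T = 1\<^sub>m (k + r)"
  proof -
    have "G * T = U * (?F * ((P' * P) * (R * U')))" by (simp add: G_def T_def mult_assoc_dim dims)
    also have "\<dots> = U * ((?F * R) * U')" using car by (simp add: Y.U' mult_assoc_dim dims)
    finally show ?thesis using car by (simp add: R X.U')
  qed
  have GD: "G * Y.D = X.D * H"
  proof -
    have "G * Y.D = U * (?F * (P' * Y.D))" by (simp add: G_def mult_assoc_dim dims)
    also have "\<dots> = U * ((?F * Y.B) * Q)" by (simp add: Y.BV[symmetric] mult_assoc_dim dims)
    also have "\<dots> = (U * X.B) * (?F * Q)" unfolding FB by (simp add: mult_assoc_dim dims)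
    also have "\<dots> = X.D * H" unfolding X.UB H_def by (simp add: mult_assoc_dim dims)
    finally show ?thesis .
  qed
  \<comment> \<open>\<open>P * Q\<close> and \<open>U * V\<close> are the changes from domain to
    target coordinates, that is, the identity written in two bases, so the push-forward commutes
    with them.\<close>
  have GW: "G * (P * Q) = U * V * H"
  proof -
    have "G * (P * Q) = U * (?F * ((P' * P) * Q))" by (simp add: G_def mult_assoc_dim dims)
    also have "\<dots> = U * (?F * Q)" using car by (simp add: Y.U')
    also have "\<dots> = U * ((V * V') * (?F * Q))" using car by (simp add: X.V')
    also have "\<dots> = U * V * H" by (simp add: H_def mult_assoc_dim dims)
    finally show ?thesis .
  qed
  note blocks = intertwining_blocks[OF GHT GT mat_diag_dim X.det_D1_nonzero mat_diag_dim
      Y.det_D1_nonzero GD[unfolded X.D_def Y.D_def] X.W Y.W GW[unfolded X.UV Y.UV]]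
  \<comment> \<open>Each \<open>m\<close> is known up to sign as the determinant of the lower right
    block, which suffices for divisibility.\<close>
  have m: "mX X dvd mX Y" if "delta X = 0" "delta Y = 0"
    using blocks(1) X.delta_zero(2)[OF that(1)] Y.delta_zero(2)[OF that(2)]
    by (metis abs_dvd_iff dvd_abs_iff)
  have map: "BF_map Y X fV (Y.h w) = X.h (G *\<^sub>v w)" if w: "w \<in> carrier_vec (l + s)" for w
  proof -
    let ?y = "Y.of_coords (P' *\<^sub>v w)"
    have Pw: "P' *\<^sub>v w \<in> carrier_vec (l + s)" using car w by auto
    have "U' * G = (U' * U) * (?F * P')" by (simp add: G_def mult_assoc_dim dims)
    then have UG: "U' * G = ?F * P'" using car by (simp add: X.U')
    have "X.coords (C.push ?y) = ?F *\<^sub>v (P' *\<^sub>v w)"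
      by (simp add: C.coords_push Y.coords_of_coords[OF Pw])
    also have "\<dots> = U' * G *\<^sub>v w" unfolding UG
      by (rule assoc_mult_mat_vec[symmetric, OF C.F_carrier Y.U'(1) w])
    also have "\<dots> = U' *\<^sub>v (G *\<^sub>v w)" by (rule assoc_mult_mat_vec[OF X.U'(1) GHT(1) w])
    finally have "C.push ?y = X.of_coords (U' *\<^sub>v (G *\<^sub>v w))"
      using X.of_coords_coords[OF C.push_carrier] by metis
    then show ?thesis by (simp add: Y.h_def X.h_def C.BF_map_coset)
  qed
  have tors: "BF_map Y X fV ` tors (BF Y) = tors (BF X) \<and> card (tors (BF X)) dvd card (tors (BF Y))"
    if d: "delta X = 0" "delta Y = 0" and ord: "r_ord X = r_ord Y"
  proof
    have rs: "r = s" using X.delta_zero(1)[OF d(1)] Y.delta_zero(1)[OF d(2)] ord by simp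
    have "int (card (tors (BF X))) dvd int (card (tors (BF Y)))"
      using blocks(2)[OF rs] by (simp add: X.card_tors_BF Y.card_tors_BF)
    then show "card (tors (BF X)) dvd card (tors (BF Y))" by simp
    obtain G1 G2 S where G: "G1 \<in> carrier_mat k l" "G2 \<in> carrier_mat k s" "S \<in> carrier_mat r s"
      "G = four_block_mat G1 G2 (0\<^sub>m r l) S" using blocks(3) by blast
    obtain T1 T2 T4 where T: "T1 \<in> carrier_mat l k" "T2 \<in> carrier_mat l r" "T4 \<in> carrier_mat s r"
      "T = four_block_mat T1 T2 (0\<^sub>m s k) T4" using blocks(4)[OF rs] by blast
    \<comment> \<open>Both \<open>G\<close> and its right inverse \<open>T\<close> are block
      triangular and so preserve torsion vectors: \<open>G\<close> gives the inclusion into the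
      torsion of \<open>BF X\<close>, and \<open>T\<close> provides torsion preimages.\<close>
    have Gt: "G *\<^sub>v u \<in> X.presentation.torsion_vecs" if "u \<in> Y.presentation.torsion_vecs" for u
      using that GHT(1) block_upper_mult_vec_zero[OF G(1-3), of u]
      unfolding G(4)[symmetric] X.presentation.torsion_vecs_def Y.presentation.torsion_vecs_def by auto
    have Tt: "T *\<^sub>v u \<in> Y.presentation.torsion_vecs" if "u \<in> X.presentation.torsion_vecs" for u
      using that GHT(3) block_upper_mult_vec_zero[OF T(1-3), of u]
      unfolding T(4)[symmetric] X.presentation.torsion_vecs_def Y.presentation.torsion_vecs_def by auto
    show "BF_map Y X fV ` tors (BF Y) = tors (BF X)"
      unfolding X.presentation.tors_eq Y.presentation.tors_eq
    proof (intro equalityI subsetI)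
      fix a assume "a \<in> BF_map Y X fV ` Y.h ` Y.presentation.torsion_vecs"
      then obtain u where u: "u \<in> Y.presentation.torsion_vecs" "a = BF_map Y X fV (Y.h u)" by blast
      then have "a = X.h (G *\<^sub>v u)" using map by (simp add: Y.presentation.torsion_vecs_def)
      then show "a \<in> X.h ` X.presentation.torsion_vecs" using Gt[OF u(1)] by blast
    next
      fix a assume "a \<in> X.h ` X.presentation.torsion_vecs"
      then obtain u where u: "u \<in> X.presentation.torsion_vecs" "a = X.h u" by blast
      then have uc: "u \<in> carrier_vec (k + r)" by (simp add: X.presentation.torsion_vecs_def)
      have "G *\<^sub>v (T *\<^sub>v u) = u"
        using assoc_mult_mat_vec[OF GHT(1,3) uc] uc by (simp add: GT)
      then have "a = BF_map Y X fV (Y.h (T *\<^sub>v u))" using map[of "T *\<^sub>v u"] u uc GHT(3) by simp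
      then show "a \<in> BF_map Y X fV ` Y.h ` Y.presentation.torsion_vecs" using Tt[OF u(1)] by blast
    qed
  qed
  show ?thesis using C.gstar_dvd m tors by blast
qed

end
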